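(* Let $k$ be a finite field and let $(\mathscr C,\mathbb E,\mathfrak s)$ be an extriangulated category, where $\mathscr C$ is an essentially small Krull–Schmidt additive $k$-linear category. Assume that $\mathscr C$ has enough projective morphisms and enough injective morphisms, and that for all $X,Y\in\mathscr C$ and $d\in\{\mathrm I,\mathrm{II}\}$ one has $\dim_k\mathbb E_d^{i}(X,Y)<\infty$ for every $i\le 0$ and $\sum_{i\le 0}\dim_k\mathbb E_d^{i}(X,Y)<\infty$. Then for all $X,Y,L\in\mathscr C$, $$\frac{|{}_X(L,Y)|}{|\mathrm{Aut}\,Y|}\,\frac{\{L,Y\}_{\mathrm I}}{\{Y,Y\}_{\mathrm I}}\,\hbar_{XY}^L=\frac{|(X,L)_Y|}{|\mathrm{Aut}\,X|}\,\frac{\{X,L\}_{\mathrm{II}}}{\{X,X\}_{\mathrm{II}}},$$ where $$\hbar_{XY}^L=\frac{\{Y,X\}_{\mathrm{II}}}{\{Y,X\}_{\mathrm I}}\,\frac{\{Y,L\}_{\mathrm I}}{\{Y,L\}_{\mathrm{II}}}\,\frac{\{L,X\}_{\mathrm I}}{\{L,X\}_{\mathrm{II}}}\,\frac{\{L,L\}_{\mathrm{II}}}{\{L,L\}_{\mathrm I}}.$$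
   Context: An extriangulated category (Nakaoka–Palu) is a triple $(\mathscr C,\mathbb E,\mathfrak s)$ as follows. (ET1) $\mathscr C$ is additive and $\mathbb E:\mathscr C^{op}\times\mathscr C\to Ab$ is a biadditive functor; elements $\delta\in\mathbb E(C,A)$ are called extensions; for $a:A\to A'$, $c:C'\to C$ put $a_*\delta=\mathbb E(C,a)(\delta)$, $c^*\delta=\mathbb E(c,A)(\delta)$; a morphism from $\delta\in\mathbb E(C,A)$ to $\delta'\in\mathbb E(C',A')$ is a pair $(a:A\to A',c:C\to C')$ with $a_*\delta=c^*\delta'$. (ET2) $\mathfrak s$ assigns to each $\delta\in\mathbb E(C,A)$ an equivalence class $[A\to B\to C]$ of sequences (two sequences $A\to B\to C$ and $A\to B'\to C$ are equivalent if there is an isomorphism $B\cong B'$ compatible with the identities of $A$ and $C$), such that every morphism $(a,c):\delta\to\delta'$ is realized by some $(a,b,c)$ making both squares between representing sequences commute, $\mathfrak s(0)$ is the class of the split sequence $A\to A\oplus C\to C$, and $\mathfrak s(\delta\oplus\delta')=\mathfrak s(\delta)\oplus\mathfrak s(\delta')$. (ET3) If $\mathfrak s(\delta)=[A\xrightarrow{x}B\xrightarrow{y}C]$, $\mathfrak s(\delta')=[A'\xrightarrow{x'}B'\xrightarrow{y'}C']$ and $bx=x'a$, there is $c$ with $cy=y'b$ and $a_*\delta=c^*\delta'$. (ET4) If $\delta\in\mathbb E(D,A)$, $\delta'\in\mathbb E(F,B)$ are realized by $A\xrightarrow{f}B\xrightarrow{f'}D$ and $B\xrightarrow{g}C\xrightarrow{g'}F$,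 there are an object $E$, an extension $\delta''\in\mathbb E(E,A)$ realized by $A\xrightarrow{h}C\xrightarrow{h'}E$ with $h=gf$, and a sequence $D\xrightarrow{d}E\xrightarrow{e}F$ realizing $f'_*\delta'$, with $h'g=df'$, $eh'=g'$, $d^*\delta''=\delta$, $f_*\delta''=e^*\delta'$. The duals of (ET3) and (ET4) also hold. If $\mathfrak s(\delta)=[A\xrightarrow{x}B\xrightarrow{y}C]$, then $A\xrightarrow{x}B\xrightarrow{y}C\overset{\delta}{\dashrightarrow}$ is called an $\mathbb E$-triangle, $x$ an inflation, $y$ a deflation, $C=\mathrm{cone}(x)$ and $A=\mathrm{cocone}(y)$ (well defined up to isomorphism). A morphism $f$ is projective if $\mathbb E(f,-)=f^*$ is zero, and injective if $\mathbb E(-,f)=f_*$ is zero. $\mathscr C$ has enough projective morphisms if every $C\in\mathscr C$ admits a deflation $G\to C$ that is a projective morphism; it has enough injective morphisms if every $A\in\mathscr C$ admits an inflation $A\to J$ that is an injective morphism. Negative extensions (Gorsky–Nakaoka–Palu), up to natural isomorphism: $\mathbb E^0_{\mathrm I}=\mathbb E^0_{\mathrm{II}}=\mathrm{Hom}$. For $n\ge1$ and an $\mathbb E$-triangle $K\to G\xrightarrow{g}C\dashrightarrow$ with $g$ a projective morphism, $\mathbb E_{\mathrm I}^{-n}(X,C)=\mathrm{Ker}\big(\mathbb E_{\mathrm I}^{-n+1}(X,K)\to\mathbb E_{\mathrm I}^{-n+1}(X,G)\big)$. Dually, for an $\mathbb E$-triangle $A\xrightarrow{j}J\to S\dashrightarrow$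 with $j$ an injective morphism, $\mathbb E_{\mathrm{II}}^{-n}(A,X)=\mathrm{Ker}\big(\mathbb E_{\mathrm{II}}^{-n+1}(S,X)\to\mathbb E_{\mathrm{II}}^{-n+1}(J,X)\big)$. These do not depend on the choices, up to isomorphism. Notation: $(X,L)_Y$ is the set of inflations $f:X\to L$ with $\mathrm{cone}(f)\cong Y$; ${}_X(L,Y)$ is the set of deflations $g:L\to Y$ with $\mathrm{cocone}(g)\cong X$. For $d\in\{\mathrm I,\mathrm{II}\}$, $\{X,Y\}_d:=\prod_{i>0}|\mathbb E_d^{-i}(X,Y)|^{(-1)^i}$. *)

theory Defs
  imports "HOL-Analysis.Infinite_Products"
begin

section \<open>Data of a linear category with extensions\<close>

text \<open>
  Every element of \<open>'o\<close> is an object, so the category is small: an essentially small category is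
  represented by an equivalent small one.  The spaces \<open>Hom X Y\<close> are subspaces of one ambient vector
  space and the groups \<open>Ext C A\<close>, standing for \<open>\<bbbE>(C,A)\<close>, are subgroups of one ambient abelian
  group.  This is no restriction (take the direct sums of all Hom spaces and of all extension
  groups), and it is what allows composition and the two actions on extensions to be written without
  object arguments.  Hom spaces of different pairs of objects may overlap, and only the values of the
  operations on suitably typed arguments matter.

  \<open>push a \<delta>\<close> and \<open>pull c \<delta>\<close> are \<open>a\<^sub>*\<delta>\<close> and \<open>c\<^sup>*\<delta>\<close>.  \<open>realization C A \<delta>\<close> is the equivalence class of
  sequences assigned to \<open>\<delta> \<in> \<bbbE>(C,A)\<close>; the triple \<open>(B, x, y)\<close> stands for the sequence
  \<open>A \<rightarrow> B \<rightarrow> C\<close> with maps \<open>x\<close> and \<open>y\<close>.  The objects are arguments of \<open>realization\<close> because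
  \<open>0\<close> lies in every extension group.
\<close>

record ('k, 'o, 'm, 'e) ext_cat =
  scale :: "'k \<Rightarrow> 'm \<Rightarrow> 'm"
  Hom :: "'o \<Rightarrow> 'o \<Rightarrow> 'm set"
  idm :: "'o \<Rightarrow> 'm"
  cmp :: "'m \<Rightarrow> 'm \<Rightarrow> 'm"  (infixr \<open>\<odot>\<index>\<close> 75)
  Ext :: "'o \<Rightarrow> 'o \<Rightarrow> 'e set"
  push :: "'m \<Rightarrow> 'e \<Rightarrow> 'e"
  pull :: "'m \<Rightarrow> 'e \<Rightarrow> 'e"
  realization :: "'o \<Rightarrow> 'o \<Rightarrow> 'e \<Rightarrow> ('o \<times> 'm \<times> 'm) set"

section \<open>Additive, linear and Krull--Schmidt categories\<close>

locale linear_category =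
  fixes C :: "('k::field, 'o, 'm::ab_group_add, 'e::ab_group_add) ext_cat" (structure)
  assumes scale_vector_space: "vector_space (scale C)"
    and Hom_subspace: "module.subspace (scale C) (Hom C X Y)"
    and idm_in_Hom: "idm C X \<in> Hom C X X"
    and cmp_in_Hom: "f \<in> Hom C X Y \<Longrightarrow> g \<in> Hom C Y Z \<Longrightarrow> g \<odot> f \<in> Hom C X Z"
    and cmp_idm_right: "f \<in> Hom C X Y \<Longrightarrow> f \<odot> idm C X = f"
    and cmp_idm_left: "f \<in> Hom C X Y \<Longrightarrow> idm C Y \<odot> f = f"
    and cmp_assoc: "f \<in> Hom C W X \<Longrightarrow> g \<in> Hom C X Y \<Longrightarrow> h \<in> Hom C Y Z \<Longrightarrow>
          (h \<odot> g) \<odot> f = h \<odot> (g \<odot> f)"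
    and cmp_add_right: "f \<in> Hom C X Y \<Longrightarrow> f' \<in> Hom C X Y \<Longrightarrow> g \<in> Hom C Y Z \<Longrightarrow>
          g \<odot> (f + f') = g \<odot> f + g \<odot> f'"
    and cmp_add_left: "f \<in> Hom C X Y \<Longrightarrow> g \<in> Hom C Y Z \<Longrightarrow> g' \<in> Hom C Y Z \<Longrightarrow>
          (g + g') \<odot> f = g \<odot> f + g' \<odot> f"
    and cmp_scale_right: "f \<in> Hom C X Y \<Longrightarrow> g \<in> Hom C Y Z \<Longrightarrow>
          g \<odot> scale C r f = scale C r (g \<odot> f)"
    and cmp_scale_left: "f \<in> Hom C X Y \<Longrightarrow> g \<in> Hom C Y Z \<Longrightarrow>
          scale C r g \<odot> f = scale C r (g \<odot> f)"

definition iso_mor :: "('k, 'o, 'm, 'e) ext_cat \<Rightarrow> 'o \<Rightarrow> 'o \<Rightarrow> 'm \<Rightarrow> bool" where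
  "iso_mor C X Y f \<longleftrightarrow>
     f \<in> Hom C X Y \<and> (\<exists>g\<in>Hom C Y X. g \<odot>\<^bsub>C\<^esub> f = idm C X \<and> f \<odot>\<^bsub>C\<^esub> g = idm C Y)"

definition isomorphic :: "('k, 'o, 'm, 'e) ext_cat \<Rightarrow> 'o \<Rightarrow> 'o \<Rightarrow> bool" where
  "isomorphic C X Y \<longleftrightarrow> (\<exists>f. iso_mor C X Y f)"

definition Aut :: "('k, 'o, 'm, 'e) ext_cat \<Rightarrow> 'o \<Rightarrow> 'm set" where
  "Aut C X = {f. iso_mor C X X f}"

definition zero_object :: "('k, 'o, 'm::ab_group_add, 'e) ext_cat \<Rightarrow> 'o \<Rightarrow> bool" where
  "zero_object C Z \<longleftrightarrow> (\<forall>X. Hom C Z X = {0} \<and> Hom C X Z = {0})"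

definition biproduct ::
    "('k, 'o, 'm::ab_group_add, 'e) ext_cat \<Rightarrow> 'o \<Rightarrow> 'o \<Rightarrow> 'o \<Rightarrow> 'm \<Rightarrow> 'm \<Rightarrow> 'm \<Rightarrow> 'm \<Rightarrow> bool" where
  "biproduct C A B S i j p q \<longleftrightarrow>
     i \<in> Hom C A S \<and> j \<in> Hom C B S \<and> p \<in> Hom C S A \<and> q \<in> Hom C S B \<and>
     p \<odot>\<^bsub>C\<^esub> i = idm C A \<and> q \<odot>\<^bsub>C\<^esub> j = idm C B \<and> p \<odot>\<^bsub>C\<^esub> j = 0 \<and> q \<odot>\<^bsub>C\<^esub> i = 0 \<and>
     i \<odot>\<^bsub>C\<^esub> p + j \<odot>\<^bsub>C\<^esub> q = idm C S"

locale additive_linear_category = linear_category +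
  assumes zero_object_exists: "\<exists>Z. zero_object C Z"
    and biproduct_exists: "\<exists>S i j p q. biproduct C A B S i j p q"

definition direct_sum ::
    "('k, 'o, 'm::ab_group_add, 'e) ext_cat \<Rightarrow> nat \<Rightarrow> (nat \<Rightarrow> 'o) \<Rightarrow> 'o \<Rightarrow> bool" where
  "direct_sum C n Z X \<longleftrightarrow>
     (\<exists>i p. (\<forall>a<n. i a \<in> Hom C (Z a) X \<and> p a \<in> Hom C X (Z a)) \<and>
            (\<forall>a<n. \<forall>b<n. p a \<odot>\<^bsub>C\<^esub> i b = (if a = b then idm C (Z a) else 0)) \<and>
            (\<Sum>a<n. i a \<odot>\<^bsub>C\<^esub> p a) = idm C X)"

text \<open>The endomorphism ring is local: it is nonzero and its non-units are closed under addition.\<close>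

definition local_End :: "('k, 'o, 'm::ab_group_add, 'e) ext_cat \<Rightarrow> 'o \<Rightarrow> bool" where
  "local_End C X \<longleftrightarrow> idm C X \<noteq> 0 \<and>
     (\<forall>f\<in>Hom C X X. \<forall>g\<in>Hom C X X. f \<notin> Aut C X \<longrightarrow> g \<notin> Aut C X \<longrightarrow> f + g \<notin> Aut C X)"

definition Krull_Schmidt :: "('k, 'o, 'm::ab_group_add, 'e) ext_cat \<Rightarrow> bool" where
  "Krull_Schmidt C \<longleftrightarrow> (\<forall>X. \<exists>n Z. (\<forall>a<n. local_End C (Z a)) \<and> direct_sum C n Z X)"

section \<open>Extriangulated categories\<close>

definition seq_equiv ::
    "('k, 'o, 'm, 'e) ext_cat \<Rightarrow> 'o \<Rightarrow> 'o \<Rightarrow> 'o \<times> 'm \<times> 'm \<Rightarrow> 'o \<times> 'm \<times> 'm \<Rightarrow> bool" where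
  "seq_equiv C A D = (\<lambda>(B, x, y) (B', x', y').
     x \<in> Hom C A B \<and> y \<in> Hom C B D \<and> x' \<in> Hom C A B' \<and> y' \<in> Hom C B' D \<and>
     (\<exists>b. iso_mor C B B' b \<and> b \<odot>\<^bsub>C\<^esub> x = x' \<and> y' \<odot>\<^bsub>C\<^esub> b = y))"

text \<open>\<open>etriangle C A B D x y \<delta>\<close>: \<open>A \<rightarrow> B \<rightarrow> D\<close> with maps \<open>x\<close>, \<open>y\<close> is an \<open>\<bbbE>\<close>-triangle
  realizing \<open>\<delta> \<in> \<bbbE>(D,A)\<close>.\<close>

definition etriangle ::
    "('k, 'o, 'm, 'e) ext_cat \<Rightarrow> 'o \<Rightarrow> 'o \<Rightarrow> 'o \<Rightarrow> 'm \<Rightarrow> 'm \<Rightarrow> 'e \<Rightarrow> bool" where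
  "etriangle C A B D x y \<delta> \<longleftrightarrow> \<delta> \<in> Ext C D A \<and> (B, x, y) \<in> realization C D A \<delta>"

text \<open>In \<open>real_sum\<close> the extension is \<open>\<delta> \<oplus> \<delta>'\<close>, the element of \<open>\<bbbE>(D \<oplus> D', A \<oplus> A')\<close> with
  components \<open>(\<delta>, 0, 0, \<delta>')\<close>, and the two maps are \<open>x \<oplus> x'\<close> and \<open>y \<oplus> y'\<close>.\<close>

locale extriangulated_category = additive_linear_category C
  for C :: "('k::field, 'o, 'm::ab_group_add, 'e::ab_group_add) ext_cat" (structure) +
  \<comment> \<open>(ET1)\<close>
  assumes Ext_zero: "0 \<in> Ext C D A"
    and Ext_add: "\<delta> \<in> Ext C D A \<Longrightarrow> \<epsilon> \<in> Ext C D A \<Longrightarrow> \<delta> + \<epsilon> \<in> Ext C D A"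
    and Ext_uminus: "\<delta> \<in> Ext C D A \<Longrightarrow> - \<delta> \<in> Ext C D A"
    and push_in_Ext: "\<delta> \<in> Ext C D A \<Longrightarrow> a \<in> Hom C A A' \<Longrightarrow> push C a \<delta> \<in> Ext C D A'"
    and pull_in_Ext: "\<delta> \<in> Ext C D A \<Longrightarrow> d \<in> Hom C D' D \<Longrightarrow> pull C d \<delta> \<in> Ext C D' A"
    and push_add: "\<delta> \<in> Ext C D A \<Longrightarrow> \<epsilon> \<in> Ext C D A \<Longrightarrow> a \<in> Hom C A A' \<Longrightarrow>
          push C a (\<delta> + \<epsilon>) = push C a \<delta> + push C a \<epsilon>"
    and pull_add: "\<delta> \<in> Ext C D A \<Longrightarrow> \<epsilon> \<in> Ext C D A \<Longrightarrow> d \<in> Hom C D' D \<Longrightarrow>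
          pull C d (\<delta> + \<epsilon>) = pull C d \<delta> + pull C d \<epsilon>"
    and push_idm: "\<delta> \<in> Ext C D A \<Longrightarrow> push C (idm C A) \<delta> = \<delta>"
    and pull_idm: "\<delta> \<in> Ext C D A \<Longrightarrow> pull C (idm C D) \<delta> = \<delta>"
    and push_cmp: "\<delta> \<in> Ext C D A \<Longrightarrow> a \<in> Hom C A A' \<Longrightarrow> a' \<in> Hom C A' A'' \<Longrightarrow>
          push C (a' \<odot> a) \<delta> = push C a' (push C a \<delta>)"
    and pull_cmp: "\<delta> \<in> Ext C D A \<Longrightarrow> d \<in> Hom C D' D \<Longrightarrow> d' \<in> Hom C D'' D' \<Longrightarrow>
          pull C (d \<odot> d') \<delta> = pull C d' (pull C d \<delta>)"
    and push_pull: "\<delta> \<in> Ext C D A \<Longrightarrow> a \<in> Hom C A A' \<Longrightarrow> d \<in> Hom C D' D \<Longrightarrow>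
          push C a (pull C d \<delta>) = pull C d (push C a \<delta>)"
    and push_add_mor: "\<delta> \<in> Ext C D A \<Longrightarrow> a \<in> Hom C A A' \<Longrightarrow> b \<in> Hom C A A' \<Longrightarrow>
          push C (a + b) \<delta> = push C a \<delta> + push C b \<delta>"
    and pull_add_mor: "\<delta> \<in> Ext C D A \<Longrightarrow> c \<in> Hom C D' D \<Longrightarrow> d \<in> Hom C D' D \<Longrightarrow>
          pull C (c + d) \<delta> = pull C c \<delta> + pull C d \<delta>"
  \<comment> \<open>(ET2)\<close>
    and real_class: "\<delta> \<in> Ext C D A \<Longrightarrow>
          \<exists>B x y. x \<in> Hom C A B \<and> y \<in> Hom C B D \<and>
            realization C D A \<delta> = Collect (seq_equiv C A D (B, x, y))"
    and real_mor: "etriangle C A B D x y \<delta> \<Longrightarrow> etriangle C A' B' D' x' y' \<delta>' \<Longrightarrow>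
          a \<in> Hom C A A' \<Longrightarrow> d \<in> Hom C D D' \<Longrightarrow> push C a \<delta> = pull C d \<delta>' \<Longrightarrow>
          \<exists>b\<in>Hom C B B'. b \<odot> x = x' \<odot> a \<and> y' \<odot> b = d \<odot> y"
    and real_zero: "biproduct C A D S i j p q \<Longrightarrow> etriangle C A S D i q 0"
    and real_sum: "etriangle C A B D x y \<delta> \<Longrightarrow> etriangle C A' B' D' x' y' \<delta>' \<Longrightarrow>
          biproduct C A A' SA iA jA pA qA \<Longrightarrow> biproduct C B B' SB iB jB pB qB \<Longrightarrow>
          biproduct C D D' SD iD jD pD qD \<Longrightarrow>
          etriangle C SA SB SD (iB \<odot> x \<odot> pA + jB \<odot> x' \<odot> qA) (iD \<odot> y \<odot> pB + jD \<odot> y' \<odot> qB)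
            (push C iA (pull C pD \<delta>) + push C jA (pull C qD \<delta>'))"
  \<comment> \<open>(ET3) and its dual\<close>
    and ET3: "etriangle C A B D x y \<delta> \<Longrightarrow> etriangle C A' B' D' x' y' \<delta>' \<Longrightarrow>
          a \<in> Hom C A A' \<Longrightarrow> b \<in> Hom C B B' \<Longrightarrow> b \<odot> x = x' \<odot> a \<Longrightarrow>
          \<exists>d\<in>Hom C D D'. d \<odot> y = y' \<odot> b \<and> push C a \<delta> = pull C d \<delta>'"
    and ET3_op: "etriangle C A B D x y \<delta> \<Longrightarrow> etriangle C A' B' D' x' y' \<delta>' \<Longrightarrow>
          b \<in> Hom C B B' \<Longrightarrow> d \<in> Hom C D D' \<Longrightarrow> d \<odot> y = y' \<odot> b \<Longrightarrow>
          \<exists>a\<in>Hom C A A'. b \<odot> x = x' \<odot> a \<and> push C a \<delta> = pull C d \<delta>'"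
  \<comment> \<open>(ET4) and its dual\<close>
    and ET4: "etriangle C A B D f f' \<delta> \<Longrightarrow> etriangle C B M F g g' \<delta>' \<Longrightarrow>
          \<exists>E h' d e \<delta>''. etriangle C A M E (g \<odot> f) h' \<delta>'' \<and>
            etriangle C D E F d e (push C f' \<delta>') \<and>
            h' \<odot> g = d \<odot> f' \<and> e \<odot> h' = g' \<and>
            pull C d \<delta>'' = \<delta> \<and> push C f \<delta>'' = pull C e \<delta>'"
    and ET4_op: "etriangle C D B A f' f \<delta> \<Longrightarrow> etriangle C F M B g' g \<delta>' \<Longrightarrow>
          \<exists>E h' d e \<delta>''. etriangle C E M A h' (f \<odot> g) \<delta>'' \<and>
            etriangle C F E D e d (pull C f' \<delta>') \<and>
            g \<odot> h' = f' \<odot> d \<and> h' \<odot> e = g' \<and>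
            push C d \<delta>'' = \<delta> \<and> pull C f \<delta>'' = push C e \<delta>'"

definition inflations_with_cone :: "('k, 'o, 'm, 'e) ext_cat \<Rightarrow> 'o \<Rightarrow> 'o \<Rightarrow> 'o \<Rightarrow> 'm set" where
  "inflations_with_cone C X L Y =
     {f. \<exists>D g \<delta>. etriangle C X L D f g \<delta> \<and> isomorphic C D Y}"

definition deflations_with_cocone :: "('k, 'o, 'm, 'e) ext_cat \<Rightarrow> 'o \<Rightarrow> 'o \<Rightarrow> 'o \<Rightarrow> 'm set" where
  "deflations_with_cocone C X L Y =
     {g. \<exists>A f \<delta>. etriangle C A L Y f g \<delta> \<and> isomorphic C A X}"

section \<open>Projective and injective morphisms\<close>

definition projective_mor :: "('k, 'o, 'm, 'e::ab_group_add) ext_cat \<Rightarrow> 'o \<Rightarrow> 'o \<Rightarrow> 'm \<Rightarrow> bool" where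
  "projective_mor C X Y f \<longleftrightarrow> f \<in> Hom C X Y \<and> (\<forall>A. \<forall>\<delta>\<in>Ext C Y A. pull C f \<delta> = 0)"

definition injective_mor :: "('k, 'o, 'm, 'e::ab_group_add) ext_cat \<Rightarrow> 'o \<Rightarrow> 'o \<Rightarrow> 'm \<Rightarrow> bool" where
  "injective_mor C X Y f \<longleftrightarrow> f \<in> Hom C X Y \<and> (\<forall>D. \<forall>\<delta>\<in>Ext C D X. push C f \<delta> = 0)"

definition enough_projective_mors :: "('k, 'o, 'm, 'e::ab_group_add) ext_cat \<Rightarrow> bool" where
  "enough_projective_mors C \<longleftrightarrow>
     (\<forall>Z. \<exists>K G k g \<delta>. etriangle C K G Z k g \<delta> \<and> projective_mor C G Z g)"

definition enough_injective_mors :: "('k, 'o, 'm, 'e::ab_group_add) ext_cat \<Rightarrow> bool" where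
  "enough_injective_mors C \<longleftrightarrow>
     (\<forall>Z. \<exists>J S j s \<delta>. etriangle C Z J S j s \<delta> \<and> injective_mor C Z J j)"

section \<open>Negative extensions\<close>

text \<open>
  Negative extensions are built from a choice, for every object, of an \<open>\<bbbE>\<close>-triangle ending in it
  whose deflation is a projective morphism (type I), respectively of one starting in it whose
  inflation is an injective morphism (type II).
\<close>

record ('o, 'm, 'e) etri =
  fst_ob :: 'o
  mid_ob :: 'o
  lst_ob :: 'o
  infl :: 'm
  defl :: 'm
  ext_class :: 'e

definition etri_in :: "('k, 'o, 'm, 'e) ext_cat \<Rightarrow> ('o, 'm, 'e) etri \<Rightarrow> bool" where
  "etri_in C T \<longleftrightarrow>
     etriangle C (fst_ob T) (mid_ob T) (lst_ob T) (infl T) (defl T) (ext_class T)"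

definition projective_presentations ::
    "('k, 'o, 'm, 'e::ab_group_add) ext_cat \<Rightarrow> ('o \<Rightarrow> ('o, 'm, 'e) etri) \<Rightarrow> bool" where
  "projective_presentations C P \<longleftrightarrow>
     (\<forall>Z. etri_in C (P Z) \<and> lst_ob (P Z) = Z \<and> projective_mor C (mid_ob (P Z)) Z (defl (P Z)))"

definition injective_presentations ::
    "('k, 'o, 'm, 'e::ab_group_add) ext_cat \<Rightarrow> ('o \<Rightarrow> ('o, 'm, 'e) etri) \<Rightarrow> bool" where
  "injective_presentations C J \<longleftrightarrow>
     (\<forall>Z. etri_in C (J Z) \<and> fst_ob (J Z) = Z \<and> injective_mor C Z (mid_ob (J Z)) (infl (J Z)))"

text \<open>
  The kernels defining \<open>\<bbbE>\<^sup>-\<^sup>n\<close> require the functoriality of the preceding level.  Given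
  \<open>\<bbbE>\<close>-triangles \<open>K \<rightarrow> G \<rightarrow> Z\<close> and \<open>K' \<rightarrow> G' \<rightarrow> Z'\<close> with classes \<open>\<delta>\<close>, \<open>\<delta>'\<close> and with projective
  deflations, every \<open>f : Z \<rightarrow> Z'\<close> has some \<open>a : K \<rightarrow> K'\<close> with \<open>a\<^sub>*\<delta> = f\<^sup>*\<delta>'\<close> (as
  \<open>f\<^sup>*\<delta>'\<close> vanishes on \<open>G\<close>).  Two such \<open>a\<close> differ by a morphism that factors through \<open>K \<rightarrow> G\<close>,
  hence induce the same map on \<open>\<bbbE>\<^sup>-\<^sup>n(X,Z)\<close>.  Thus \<open>\<bbbE>\<^sup>-\<^sup>n(X,f)\<close> is the restriction of
  \<open>\<bbbE>\<^sup>-\<^sup>n\<^sup>+\<^sup>1(X,a)\<close> and does not depend on the choice of \<open>a\<close>.  Type II is dual.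
\<close>

definition proj_lift ::
    "('k, 'o, 'm, 'e) ext_cat \<Rightarrow> ('o \<Rightarrow> ('o, 'm, 'e) etri) \<Rightarrow> 'o \<Rightarrow> 'o \<Rightarrow> 'm \<Rightarrow> 'm" where
  "proj_lift C P Z Z' f =
     (SOME a. a \<in> Hom C (fst_ob (P Z)) (fst_ob (P Z')) \<and>
        push C a (ext_class (P Z)) = pull C f (ext_class (P Z')))"

definition inj_lift ::
    "('k, 'o, 'm, 'e) ext_cat \<Rightarrow> ('o \<Rightarrow> ('o, 'm, 'e) etri) \<Rightarrow> 'o \<Rightarrow> 'o \<Rightarrow> 'm \<Rightarrow> 'm" where
  "inj_lift C J Z Z' f =
     (SOME c. c \<in> Hom C (lst_ob (J Z)) (lst_ob (J Z')) \<and>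
        push C f (ext_class (J Z)) = pull C c (ext_class (J Z')))"

text \<open>\<open>negI_map C P n Z Z' f\<close> is \<open>\<bbbE>\<^sub>I\<^sup>-\<^sup>n(X,f) : \<bbbE>\<^sub>I\<^sup>-\<^sup>n(X,Z) \<rightarrow> \<bbbE>\<^sub>I\<^sup>-\<^sup>n(X,Z')\<close> for
  \<open>f : Z \<rightarrow> Z'\<close>, and \<open>negI C P n X Z\<close> is \<open>\<bbbE>\<^sub>I\<^sup>-\<^sup>n(X,Z)\<close>.\<close>

primrec negI_map ::
    "('k, 'o, 'm, 'e) ext_cat \<Rightarrow> ('o \<Rightarrow> ('o, 'm, 'e) etri) \<Rightarrow> nat \<Rightarrow> 'o \<Rightarrow> 'o \<Rightarrow> 'm \<Rightarrow> 'm \<Rightarrow> 'm" where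
  "negI_map C P 0 Z Z' f \<phi> = f \<odot>\<^bsub>C\<^esub> \<phi>"
| "negI_map C P (Suc n) Z Z' f \<phi> =
     negI_map C P n (fst_ob (P Z)) (fst_ob (P Z')) (proj_lift C P Z Z' f) \<phi>"

primrec negI ::
    "('k, 'o, 'm::zero, 'e) ext_cat \<Rightarrow> ('o \<Rightarrow> ('o, 'm, 'e) etri) \<Rightarrow> nat \<Rightarrow> 'o \<Rightarrow> 'o \<Rightarrow> 'm set" where
  "negI C P 0 X Z = Hom C X Z"
| "negI C P (Suc n) X Z =
     {\<phi> \<in> negI C P n X (fst_ob (P Z)).
        negI_map C P n (fst_ob (P Z)) (mid_ob (P Z)) (infl (P Z)) \<phi> = 0}"

text \<open>\<open>negII_map C J n Z Z' f\<close> is \<open>\<bbbE>\<^sub>I\<^sub>I\<^sup>-\<^sup>n(f,X) : \<bbbE>\<^sub>I\<^sub>I\<^sup>-\<^sup>n(Z',X) \<rightarrow> \<bbbE>\<^sub>I\<^sub>I\<^sup>-\<^sup>n(Z,X)\<close> for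
  \<open>f : Z \<rightarrow> Z'\<close>, and \<open>negII C J n Z X\<close> is \<open>\<bbbE>\<^sub>I\<^sub>I\<^sup>-\<^sup>n(Z,X)\<close>.\<close>

primrec negII_map ::
    "('k, 'o, 'm, 'e) ext_cat \<Rightarrow> ('o \<Rightarrow> ('o, 'm, 'e) etri) \<Rightarrow> nat \<Rightarrow> 'o \<Rightarrow> 'o \<Rightarrow> 'm \<Rightarrow> 'm \<Rightarrow> 'm" where
  "negII_map C J 0 Z Z' f \<phi> = \<phi> \<odot>\<^bsub>C\<^esub> f"
| "negII_map C J (Suc n) Z Z' f \<phi> =
     negII_map C J n (lst_ob (J Z)) (lst_ob (J Z')) (inj_lift C J Z Z' f) \<phi>"

primrec negII ::
    "('k, 'o, 'm::zero, 'e) ext_cat \<Rightarrow> ('o \<Rightarrow> ('o, 'm, 'e) etri) \<Rightarrow> nat \<Rightarrow> 'o \<Rightarrow> 'o \<Rightarrow> 'm set" where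
  "negII C J 0 Z X = Hom C Z X"
| "negII C J (Suc n) Z X =
     {\<phi> \<in> negII C J n (lst_ob (J Z)) X.
        negII_map C J n (mid_ob (J Z)) (lst_ob (J Z)) (defl (J Z)) \<phi> = 0}"

section \<open>Dimensions and counting factors\<close>

definition fin_dim :: "('k::field, 'o, 'm::ab_group_add, 'e) ext_cat \<Rightarrow> 'm set \<Rightarrow> bool" where
  "fin_dim C V \<longleftrightarrow> (\<exists>B. finite B \<and> V \<subseteq> module.span (scale C) B)"

text \<open>Each space has finite dimension and the dimensions have a finite sum; \<open>V n\<close> is the space in
  degree \<open>-n\<close>.  Finiteness is stated separately because \<open>dim\<close> is \<open>0\<close> on infinite-dimensional
  spaces.\<close>

definition fin_total_dim :: "('k::field, 'o, 'm::ab_group_add, 'e) ext_cat \<Rightarrow> (nat \<Rightarrow> 'm set) \<Rightarrow> bool" where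
  "fin_total_dim C V \<longleftrightarrow>
     (\<forall>n. fin_dim C (V n)) \<and> summable (\<lambda>n. real (vector_space.dim (scale C) (V n)))"

text \<open>\<open>alt_card V\<close> is the product of \<open>|V i|^((-1)^i)\<close> over all \<open>i > 0\<close>.\<close>

definition alt_card :: "(nat \<Rightarrow> 'm set) \<Rightarrow> real" where
  "alt_card V = prodinf (\<lambda>i. real (card (V (Suc i))) powi ((- 1) ^ Suc i))"

definition brI ::
    "('k, 'o, 'm::zero, 'e) ext_cat \<Rightarrow> ('o \<Rightarrow> ('o, 'm, 'e) etri) \<Rightarrow> 'o \<Rightarrow> 'o \<Rightarrow> real" where
  "brI C P X Y = alt_card (\<lambda>n. negI C P n X Y)"

definition brII ::
    "('k, 'o, 'm::zero, 'e) ext_cat \<Rightarrow> ('o \<Rightarrow> ('o, 'm, 'e) etri) \<Rightarrow> 'o \<Rightarrow> 'o \<Rightarrow> real" where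
  "brII C J X Y = alt_card (\<lambda>n. negII C J n X Y)"

definition hbar_factor ::
    "('k, 'o, 'm::zero, 'e) ext_cat \<Rightarrow> ('o \<Rightarrow> ('o, 'm, 'e) etri) \<Rightarrow> ('o \<Rightarrow> ('o, 'm, 'e) etri) \<Rightarrow>
      'o \<Rightarrow> 'o \<Rightarrow> 'o \<Rightarrow> real" where
  "hbar_factor C P J X Y L =
     (brII C J Y X / brI C P Y X) * (brI C P Y L / brII C J Y L) *
     (brI C P L X / brII C J L X) * (brII C J L L / brI C P L L)"

end

theory Submission
  imports Defs
begin

text \<open>
  Only endomorphism pairs of a fixed triangle \<open>X \<rightarrow> L \<rightarrow> Y\<close> with maps \<open>f\<close>, \<open>g\<close> have to be compared.  Let
  \<open>W\<close> be the set of pairs \<open>(f, g)\<close> that underlie a triangle.  By orbit counting,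
  \<open>|(X,L)\<^sub>Y| |Aut Y|\<close> is the sum over \<open>W\<close> of the orders of the stabilizers of \<open>g\<close> in \<open>Aut Y\<close>, and
  dually for \<open>X\<close>.  The stabilizer of \<open>g\<close> consists of the units \<open>1 + u\<close> with \<open>u g = 0\<close>, that of \<open>f\<close>
  of the units \<open>1 + v\<close> with \<open>f v = 0\<close>.  The additive relation ``\<open>(v, 0, u)\<close> is an endomorphism of the
  triangle'' projects onto both of these kernels and relates units to units, so the proportion of
  units is the same in both.  The orders of the kernels
  \<open>{\<phi> : U \<rightarrow> X | f \<phi> = 0}\<close> and \<open>{\<psi> : Y \<rightarrow> U | \<psi> g = 0}\<close> are expressed by the brackets through the
  long exact sequences of \<open>\<bbbE>\<^sub>I\<close> and \<open>\<bbbE>\<^sub>I\<^sub>I\<close>, and \<open>\<hbar>\<close> reflects an identity between the orders of these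
  kernels for \<open>U = X, Y, L\<close>.
\<close>

section \<open>Counting with subgroups\<close>

text \<open>Closure under differences makes every nonempty fibre of \<open>T\<close> a translate of
  the fibre over 0, so all fibres over points of \<open>S\<close> have the same size.\<close>

lemma card_relation_fibres:
  fixes T :: "('a::ab_group_add \<times> 'b::ab_group_add) set"
  assumes fin: "finite T"
    and diff: "\<And>a b a' b'. (a, b) \<in> T \<Longrightarrow> (a', b') \<in> T \<Longrightarrow> (a - a', b - b') \<in> T"
    and S: "S \<subseteq> Domain T"
  shows "card {p \<in> T. fst p \<in> S} = card S * card {b. (0, b) \<in> T}"
proof -
  have finS: "finite S"
    using S fin by (meson finite_Domain finite_subset)
  have "{p \<in> T. fst p \<in> S} = (SIGMA a:S. {b. (a, b) \<in> T})"
    by auto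
  moreover have "finite {b. (a, b) \<in> T}" for a
    by (rule finite_subset[of _ "Range T"]) (use fin in \<open>auto intro: finite_Range\<close>)
  moreover have "card {b. (a, b) \<in> T} = card {b. (0, b) \<in> T}" if "a \<in> S" for a
  proof -
    obtain b0 where b0: "(a, b0) \<in> T" using S \<open>a \<in> S\<close> by auto
    have neg: "(- a, - b) \<in> T" if "(a, b) \<in> T" for a b
      using diff[OF diff[OF that that] that] by simp
    have "bij_betw (\<lambda>b. b - b0) {b. (a, b) \<in> T} {b. (0, b) \<in> T}"
    proof (rule bij_betwI[where g = "\<lambda>b. b + b0"])
      show "(\<lambda>b. b - b0) \<in> {b. (a, b) \<in> T} \<rightarrow> {b. (0, b) \<in> T}"
        using diff[OF _ b0] by fastforce
      show "(\<lambda>b. b + b0) \<in> {b. (0, b) \<in> T} \<rightarrow> {b. (a, b) \<in> T}"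
        using diff[OF _ neg[OF b0]] by fastforce
    qed auto
    then show ?thesis by (rule bij_betw_same_card)
  qed
  ultimately show ?thesis
    by (simp add: card_SigmaI finS)
qed

text \<open>The pairs of \<open>T\<close> over \<open>S\<close> are exactly those over
  \<open>S'\<close>; counting them by either coordinate gives the two sides. Both sets may be
  arbitrary subsets, for instance sets of units.\<close>

lemma card_relation:
  fixes T :: "('a::ab_group_add \<times> 'b::ab_group_add) set"
  assumes fin: "finite T"
    and diff: "\<And>a b a' b'. (a, b) \<in> T \<Longrightarrow> (a', b') \<in> T \<Longrightarrow> (a - a', b - b') \<in> T"
    and S: "S \<subseteq> Domain T" and S': "S' \<subseteq> Range T"
    and SS': "\<And>a b. (a, b) \<in> T \<Longrightarrow> a \<in> S \<longleftrightarrow> b \<in> S'"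
  shows "card S * card {b. (0, b) \<in> T} = card S' * card {a. (a, 0) \<in> T}"
proof -
  have "card S * card {b. (0, b) \<in> T} = card {p \<in> T. fst p \<in> S}"
    by (rule card_relation_fibres[OF fin diff S, symmetric])
  also have "\<dots> = card {p \<in> T\<inverse>. fst p \<in> S'}"
    by (rule bij_betw_same_card[of prod.swap])
      (rule bij_betwI[where g = prod.swap], use SS' in auto)
  also have "\<dots> = card S' * card {a. (0, a) \<in> T\<inverse>}"
    by (rule card_relation_fibres) (use fin diff S' in auto)
  finally show ?thesis by simp
qed

text \<open>The graph of \<open>h\<close> is an additive relation whose fibre over 0 is trivial in
  one direction and the kernel in the other.\<close>

lemma card_image_kernel:
  fixes h :: "'a::ab_group_add \<Rightarrow> 'b::ab_group_add"
  assumes fin: "finite V" and zero: "0 \<in> V"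
    and diff: "\<And>a b. a \<in> V \<Longrightarrow> b \<in> V \<Longrightarrow> a - b \<in> V"
    and hom: "\<And>a b. a \<in> V \<Longrightarrow> b \<in> V \<Longrightarrow> h (a - b) = h a - h b"
  shows "card V = card (h ` V) * card {a \<in> V. h a = 0}"
proof -
  define T where "T = (\<lambda>a. (a, h a)) ` V"
  have h0: "h 0 = 0" using hom[OF zero zero] by simp
  have "card V * card {b. (0, b) \<in> T} = card (h ` V) * card {a. (a, 0) \<in> T}"
    by (rule card_relation) (auto simp: T_def fin diff hom Domain.simps Range.simps)
  moreover have "{b. (0, b) \<in> T} = {0}" using zero h0 by (auto simp: T_def)
  moreover have "{a. (a, 0) \<in> T} = {a \<in> V. h a = 0}" by (auto simp: T_def)
  ultimately show ?thesis by simp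
qed

section \<open>Exactness properties of extriangulated categories\<close>

context linear_category
begin

lemma Hom_0 [simp, intro]: "0 \<in> Hom C X Y"
  and Hom_add [intro]: "f \<in> Hom C X Y \<Longrightarrow> g \<in> Hom C X Y \<Longrightarrow> f + g \<in> Hom C X Y"
  and Hom_diff [intro]: "f \<in> Hom C X Y \<Longrightarrow> g \<in> Hom C X Y \<Longrightarrow> f - g \<in> Hom C X Y"
proof -
  interpret vs: vector_space "scale C" by (rule scale_vector_space)
  show "0 \<in> Hom C X Y" by (rule vs.subspace_0[OF Hom_subspace])
  show "f \<in> Hom C X Y \<Longrightarrow> g \<in> Hom C X Y \<Longrightarrow> f + g \<in> Hom C X Y"
    by (rule vs.subspace_add[OF Hom_subspace])
  show "f \<in> Hom C X Y \<Longrightarrow> g \<in> Hom C X Y \<Longrightarrow> f - g \<in> Hom C X Y"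
    by (rule vs.subspace_diff[OF Hom_subspace])
qed

declare idm_in_Hom [simp, intro] cmp_in_Hom [intro]

lemma cmp_idm_idm [simp]: "idm C X \<odot> idm C X = idm C X"
  by (rule cmp_idm_left[OF idm_in_Hom])

lemma cmp_0_right: "g \<in> Hom C Y Z \<Longrightarrow> g \<odot> 0 = 0"
  using cmp_add_right[of 0 Y Y 0 g Z] by simp

lemma cmp_0_left: "f \<in> Hom C X Y \<Longrightarrow> 0 \<odot> f = 0"
  using cmp_add_left[of f X Y 0 Y 0] by simp

lemma cmp_diff_right:
  assumes "f \<in> Hom C X Y" "f' \<in> Hom C X Y" "g \<in> Hom C Y Z"
  shows "g \<odot> (f - f') = g \<odot> f - g \<odot> f'"
  using cmp_add_right[OF Hom_diff[OF assms(1,2)] assms(2,3)] by (simp add: algebra_simps)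

lemma cmp_diff_left:
  assumes "f \<in> Hom C X Y" "g \<in> Hom C Y Z" "g' \<in> Hom C Y Z"
  shows "(g - g') \<odot> f = g \<odot> f - g' \<odot> f"
  using cmp_add_left[OF assms(1) Hom_diff[OF assms(2,3)] assms(3)] by (simp add: algebra_simps)

text \<open>The geometric series stops after two terms, so the inverse is
  \<open>idm C X - u\<close>.\<close>

lemma iso_idm_add_square_zero:
  assumes u: "u \<in> Hom C X X" and sq: "u \<odot> u = 0"
  shows "idm C X + u \<in> Aut C X"
proof -
  have "(idm C X - u) \<odot> (idm C X + u) = idm C X"
    using u sq by (simp add: cmp_diff_left[where X = X and Y = X and Z = X] Hom_add
        cmp_add_right[where X = X and Y = X and Z = X] cmp_idm_left cmp_idm_right)
  moreover have "(idm C X + u) \<odot> (idm C X - u) = idm C X"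
    using u sq by (simp add: cmp_diff_right[where X = X and Y = X and Z = X] Hom_add
        cmp_add_left[where X = X and Y = X and Z = X] cmp_idm_left cmp_idm_right)
  ultimately show ?thesis
    unfolding Aut_def iso_mor_def using u by auto
qed

text \<open>The unit \<open>g f\<close> yields a left inverse \<open>p g\<close> of
  \<open>f\<close>, the unit \<open>f g\<close> a right inverse \<open>g q\<close>, and the two must
  coincide.\<close>

lemma iso_morI_Aut:
  assumes f: "f \<in> Hom C X Y" and g: "g \<in> Hom C Y X"
    and gf: "g \<odot> f \<in> Aut C X" and fg: "f \<odot> g \<in> Aut C Y"
  shows "iso_mor C X Y f"
proof -
  obtain p where p: "p \<in> Hom C X X" "p \<odot> (g \<odot> f) = idm C X"
    using gf unfolding Aut_def iso_mor_def by auto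
  obtain q where q: "q \<in> Hom C Y Y" "(f \<odot> g) \<odot> q = idm C Y"
    using fg unfolding Aut_def iso_mor_def by auto
  have l: "(p \<odot> g) \<odot> f = idm C X"
    using cmp_assoc[OF f g p(1)] p(2) by simp
  have r: "f \<odot> (g \<odot> q) = idm C Y"
    using cmp_assoc[OF q(1) g f] q(2) by simp
  have "p \<odot> g = (p \<odot> g) \<odot> (f \<odot> (g \<odot> q))"
    using r cmp_idm_right[OF cmp_in_Hom[OF g p(1)]] by simp
  also have "\<dots> = ((p \<odot> g) \<odot> f) \<odot> (g \<odot> q)"
    using cmp_assoc[OF cmp_in_Hom[OF q(1) g] f cmp_in_Hom[OF g p(1)]] by simp
  also have "\<dots> = g \<odot> q"
    using l cmp_idm_left[OF cmp_in_Hom[OF q(1) g]] by simp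
  finally have "p \<odot> g = g \<odot> q" .
  then show ?thesis
    unfolding iso_mor_def using f l r cmp_in_Hom[OF g p(1)] by metis
qed

lemma iso_mor_inverse:
  assumes "iso_mor C X Y f"
  obtains g where "f \<in> Hom C X Y" "g \<in> Hom C Y X" "g \<odot> f = idm C X" "f \<odot> g = idm C Y"
    "iso_mor C Y X g"
  using assms unfolding iso_mor_def by blast

lemma idm_in_Aut: "idm C X \<in> Aut C X"
  unfolding Aut_def iso_mor_def by (auto intro: bexI[of _ "idm C X"])

lemma iso_mor_cmp:
  assumes "iso_mor C X Y f" "iso_mor C Y Z g"
  shows "iso_mor C X Z (g \<odot> f)"
proof -
  obtain f' where f: "f \<in> Hom C X Y" "f' \<in> Hom C Y X" "f' \<odot> f = idm C X" "f \<odot> f' = idm C Y"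
    by (rule iso_mor_inverse[OF assms(1)])
  obtain g' where g: "g \<in> Hom C Y Z" "g' \<in> Hom C Z Y" "g' \<odot> g = idm C Y" "g \<odot> g' = idm C Z"
    by (rule iso_mor_inverse[OF assms(2)])
  have "(f' \<odot> g') \<odot> (g \<odot> f) = f' \<odot> ((g' \<odot> g) \<odot> f)"
    using cmp_assoc[OF cmp_in_Hom[OF f(1) g(1)] g(2) f(2)] cmp_assoc[OF f(1) g(1) g(2)] by simp
  moreover have "(g \<odot> f) \<odot> (f' \<odot> g') = g \<odot> ((f \<odot> f') \<odot> g')"
    using cmp_assoc[OF cmp_in_Hom[OF g(2) f(2)] f(1) g(1)] cmp_assoc[OF g(2) f(2) f(1)] by simp
  ultimately show ?thesis
    unfolding iso_mor_def
    using f g cmp_idm_left[OF f(1)] cmp_idm_left[OF f(2)] cmp_idm_left[OF g(2)]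
    by (auto simp: cmp_in_Hom intro!: bexI[of _ "f' \<odot> g'"])
qed

end

section \<open>Exact sequences of Hom and extension groups\<close>

context extriangulated_category
begin

lemma push_0: "a \<in> Hom C A A' \<Longrightarrow> push C a 0 = 0"
  using push_add[OF Ext_zero Ext_zero] by force

lemma pull_0: "d \<in> Hom C D' D \<Longrightarrow> pull C d 0 = 0"
  using pull_add[OF Ext_zero Ext_zero] by force

lemma push_zero_mor: "\<delta> \<in> Ext C D A \<Longrightarrow> push C 0 \<delta> = 0"
  using push_add_mor[OF _ Hom_0[of A A] Hom_0] by force

lemma pull_zero_mor: "\<delta> \<in> Ext C D A \<Longrightarrow> pull C 0 \<delta> = 0"
  using pull_add_mor[OF _ Hom_0[of D D] Hom_0] by force

lemma push_diff_mor:
  assumes "\<delta> \<in> Ext C D A" "a \<in> Hom C A A'" "b \<in> Hom C A A'"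
  shows "push C (a - b) \<delta> = push C a \<delta> - push C b \<delta>"
  using push_add_mor[OF assms(1) Hom_diff[OF assms(2,3)] assms(3)] by (simp add: algebra_simps)

lemma pull_diff_mor:
  assumes "\<delta> \<in> Ext C D A" "a \<in> Hom C D' D" "b \<in> Hom C D' D"
  shows "pull C (a - b) \<delta> = pull C a \<delta> - pull C b \<delta>"
  using pull_add_mor[OF assms(1) Hom_diff[OF assms(2,3)] assms(3)] by (simp add: algebra_simps)

lemma etriangleD:
  assumes "etriangle C A B D x y \<delta>"
  shows "x \<in> Hom C A B" "y \<in> Hom C B D" "\<delta> \<in> Ext C D A"
  using assms real_class[of \<delta> D A] unfolding etriangle_def seq_equiv_def by auto

lemma etriangle_exists:
  assumes "\<delta> \<in> Ext C D A"
  shows "\<exists>B x y. etriangle C A B D x y \<delta>"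
proof -
  obtain B x y where *: "x \<in> Hom C A B" "y \<in> Hom C B D"
      "realization C D A \<delta> = Collect (seq_equiv C A D (B, x, y))"
    using real_class[OF assms] by blast
  then have "etriangle C A B D x y \<delta>"
    using assms idm_in_Aut[of B]
    by (auto simp: etriangle_def seq_equiv_def Aut_def cmp_idm_left cmp_idm_right)
  then show ?thesis by blast
qed

text \<open>Each realization is a full equivalence class, so membership passes along an isomorphism
  of middle terms that respects both ends.\<close>

lemma etriangle_equiv:
  assumes T: "etriangle C A B D x y \<delta>" and b: "iso_mor C B B' b"
    and y': "y' \<in> Hom C B' D" and eq: "y' \<odot> b = y"
  shows "etriangle C A B' D (b \<odot> x) y' \<delta>"
proof -
  note T' = etriangleD[OF T]
  have bh: "b \<in> Hom C B B'" using b by (auto simp: iso_mor_def)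
  obtain B0 x0 y0 where *: "x0 \<in> Hom C A B0" "y0 \<in> Hom C B0 D"
      "realization C D A \<delta> = Collect (seq_equiv C A D (B0, x0, y0))"
    using real_class[OF T'(3)] by blast
  then obtain b0 where b0: "iso_mor C B0 B b0" "b0 \<odot> x0 = x" "y \<odot> b0 = y0"
    using T by (auto simp: etriangle_def seq_equiv_def)
  have b0h: "b0 \<in> Hom C B0 B" using b0 by (auto simp: iso_mor_def)
  have "iso_mor C B0 B' (b \<odot> b0)" by (rule iso_mor_cmp[OF b0(1) b])
  moreover have "(b \<odot> b0) \<odot> x0 = b \<odot> x"
    using cmp_assoc[OF *(1) b0h bh] b0 by simp
  moreover have "y' \<odot> (b \<odot> b0) = y0"
    using cmp_assoc[OF b0h bh y'] b0 eq by simp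
  ultimately have "seq_equiv C A D (B0, x0, y0) (B', b \<odot> x, y')"
    using * y' T' bh by (auto simp: seq_equiv_def)
  then show ?thesis
    using * T' by (simp add: etriangle_def)
qed

text \<open>This split triangle and that of \<open>etriangle_zero_first\<close> turn the axioms on
  morphisms of triangles into lifting statements for single morphisms.\<close>

lemma etriangle_zero_last:
  assumes "zero_object C Z"
  shows "etriangle C U U Z (idm C U) 0 0"
proof (rule real_zero)
  have "idm C Z = 0" using assms idm_in_Hom[of Z] by (auto simp: zero_object_def)
  then show "biproduct C U Z U (idm C U) 0 (idm C U) 0"
    by (auto simp: biproduct_def cmp_0_left[OF Hom_0] intro: cmp_0_left cmp_0_right)
qed

lemma etriangle_zero_first:
  assumes "zero_object C Z"
  shows "etriangle C Z U U 0 (idm C U) 0"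
proof (rule real_zero)
  have "idm C Z = 0" using assms idm_in_Hom[of Z] by (auto simp: zero_object_def)
  then show "biproduct C Z U U 0 (idm C U) 0 (idm C U)"
    by (auto simp: biproduct_def cmp_0_left[OF Hom_0] intro: cmp_0_left cmp_0_right)
qed

context
  fixes A B D x y \<delta>
  assumes T: "etriangle C A B D x y \<delta>"
begin

lemma etriangle_cmp_zero: "y \<odot> x = 0"
proof -
  note T' = etriangleD[OF T]
  obtain Z where Z: "zero_object C Z" using zero_object_exists by blast
  obtain d where d: "d \<in> Hom C Z D" "d \<odot> 0 = y \<odot> x"
    using ET3[OF etriangle_zero_last[OF Z, of A] T idm_in_Hom T'(1) refl] by auto
  then show ?thesis using cmp_0_right by metis
qed

lemma etriangle_pull_zero: "pull C y \<delta> = 0"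
proof -
  note T' = etriangleD[OF T]
  obtain Z where Z: "zero_object C Z" using zero_object_exists by blast
  obtain d where "d \<in> Hom C Z A" "push C d 0 = pull C y \<delta>"
    using ET3_op[OF etriangle_zero_first[OF Z, of B] T idm_in_Hom T'(2) refl] by auto
  then show ?thesis using push_0 by metis
qed

text \<open>With the next two lemmas this gives the nontrivial inclusions in the exactness of
  Hom(U,A) -> Hom(U,B) -> Hom(U,D) -> Ext(U,A) and of Hom(B,U) -> Hom(A,U) -> Ext(D,U). Each
  compares the triangle with one that has a zero end.\<close>

lemma etriangle_lift_infl:
  assumes "b \<in> Hom C U B" "y \<odot> b = 0"
  shows "\<exists>a\<in>Hom C U A. b = x \<odot> a"
proof -
  obtain Z where Z: "zero_object C Z" using zero_object_exists by blast
  have "0 \<odot> 0 = y \<odot> b" using assms cmp_0_right[of 0] by simp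
  then show ?thesis
    using ET3_op[OF etriangle_zero_last[OF Z, of U] T assms(1) Hom_0] cmp_idm_right[OF assms(1)]
    by auto
qed

lemma etriangle_lift_defl:
  assumes "d \<in> Hom C U D" "pull C d \<delta> = 0"
  shows "\<exists>b\<in>Hom C U B. d = y \<odot> b"
proof -
  obtain Z where Z: "zero_object C Z" using zero_object_exists by blast
  show ?thesis
    using real_mor[OF etriangle_zero_first[OF Z, of U] T Hom_0 assms(1)] cmp_idm_right[OF assms(1)]
      assms(2) push_0[OF Hom_0] by fastforce
qed

lemma etriangle_extend_infl:
  assumes "a \<in> Hom C A U" "push C a \<delta> = 0"
  shows "\<exists>b\<in>Hom C B U. a = b \<odot> x"
proof -
  obtain Z where Z: "zero_object C Z" using zero_object_exists by blast
  show ?thesis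
    using real_mor[OF T etriangle_zero_last[OF Z, of U] assms(1) Hom_0] cmp_idm_left[OF assms(1)]
      assms(2) pull_0[OF Hom_0] by fastforce
qed

text \<open>Since \<open>y\<close> pulls \<epsilon> back to zero, it lifts through the deflation of
  a triangle realizing \<epsilon>. The dual of (ET3), with the identity on \<open>D\<close>, then
  produces \<open>a\<close>.\<close>

lemma etriangle_push_surj:
  assumes e: "\<epsilon> \<in> Ext C D A'" and z: "pull C y \<epsilon> = 0"
  shows "\<exists>a\<in>Hom C A A'. push C a \<delta> = \<epsilon>"
proof -
  note T' = etriangleD[OF T]
  obtain M m m' where M: "etriangle C A' M D m m' \<epsilon>"
    using etriangle_exists[OF e] by blast
  then obtain b where b: "b \<in> Hom C B M" "y = m' \<odot> b"
    using extriangulated_category.etriangle_lift_defl[OF extriangulated_category_axioms M T'(2) z]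
    by blast
  have "idm C D \<odot> y = m' \<odot> b" using b cmp_idm_left[OF T'(2)] by simp
  from ET3_op[OF T M b(1) idm_in_Hom this] show ?thesis
    using pull_idm[OF e] by auto
qed

end

end

section \<open>The long exact sequence of negative extensions\<close>

locale projectively_presented = extriangulated_category C
  for C :: "('k::field, 'o, 'm::ab_group_add, 'e::ab_group_add) ext_cat" (structure) +
  fixes P :: "'o \<Rightarrow> ('o, 'm, 'e) etri"
  assumes presentations: "projective_presentations C P"
begin

abbreviation "syz Z \<equiv> fst_ob (P Z)"
abbreviation "cov Z \<equiv> mid_ob (P Z)"
abbreviation "inc Z \<equiv> infl (P Z)"
abbreviation "prj Z \<equiv> defl (P Z)"
abbreviation "cls Z \<equiv> ext_class (P Z)"

lemma presentation_etriangle: "etriangle C (syz Z) (cov Z) Z (inc Z) (prj Z) (cls Z)"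
  using presentations unfolding projective_presentations_def etri_in_def by metis

lemmas presentationD = etriangleD[OF presentation_etriangle]

lemma pull_prj_zero: "\<delta> \<in> Ext C Z A \<Longrightarrow> pull C (prj Z) \<delta> = 0"
  using presentations unfolding projective_presentations_def projective_mor_def by blast

lemma syz_push:
  assumes "\<delta> \<in> Ext C Z A"
  obtains a where "a \<in> Hom C (syz Z) A" "push C a (cls Z) = \<delta>"
  using etriangle_push_surj[OF presentation_etriangle assms pull_prj_zero[OF assms]] by blast

lemma proj_lift:
  assumes "f \<in> Hom C Z Z'"
  shows "proj_lift C P Z Z' f \<in> Hom C (syz Z) (syz Z')"
    and "push C (proj_lift C P Z Z' f) (cls Z) = pull C f (cls Z')"
proof -
  have "\<exists>a. a \<in> Hom C (syz Z) (syz Z') \<and> push C a (cls Z) = pull C f (cls Z')"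
    using syz_push[OF pull_in_Ext[OF presentationD(3) assms]] by blast
  from someI_ex[OF this]
  show "proj_lift C P Z Z' f \<in> Hom C (syz Z) (syz Z')"
    and "push C (proj_lift C P Z Z' f) (cls Z) = pull C f (cls Z')"
    unfolding proj_lift_def by auto
qed

text \<open>One step of the recursion for negative extensions, stated for arbitrary values
  \<open>F\<close> and action \<open>M\<close> so that all degrees are handled by the same lemmas;
  see \<open>negI_Suc\<close>.\<close>

definition Omega :: "('o \<Rightarrow> 'x::zero set) \<Rightarrow> ('o \<Rightarrow> 'o \<Rightarrow> 'm \<Rightarrow> 'x \<Rightarrow> 'x) \<Rightarrow> 'o \<Rightarrow> 'x set" where
  "Omega F M Z = {\<phi> \<in> F (syz Z). M (syz Z) (cov Z) (inc Z) \<phi> = 0}"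

definition Omega_map ::
    "('o \<Rightarrow> 'o \<Rightarrow> 'm \<Rightarrow> 'x \<Rightarrow> 'x) \<Rightarrow> 'o \<Rightarrow> 'o \<Rightarrow> 'm \<Rightarrow> 'x \<Rightarrow> 'x" where
  "Omega_map M Z Z' f = M (syz Z) (syz Z') (proj_lift C P Z Z' f)"

text \<open>Composing a triangle with the cover of its middle term gives a second presentation \<open>E\<close> of its
  last term, which maps onto the first term; it is compared with the chosen presentation in both
  directions.\<close>

lemma horseshoe:
  assumes T: "etriangle C A B D x y \<delta>"
  obtains E h d e \<epsilon> r s where
    "etriangle C E (cov B) D h (y \<odot> prj B) \<epsilon>"
    "etriangle C (syz B) E A e d (pull C x (cls B))"
    "prj B \<odot> h = x \<odot> d" "h \<odot> e = inc B" "push C d \<epsilon> = \<delta>" "pull C y \<epsilon> = push C e (cls B)"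
    "r \<in> Hom C E (syz D)" "push C r \<epsilon> = cls D" "s \<in> Hom C (syz D) E" "push C s (cls D) = \<epsilon>"
proof -
  note T' = etriangleD[OF T]
  obtain E h d e \<epsilon> where *: "etriangle C E (cov B) D h (y \<odot> prj B) \<epsilon>"
    "etriangle C (syz B) E A e d (pull C x (cls B))"
    "prj B \<odot> h = x \<odot> d" "h \<odot> e = inc B" "push C d \<epsilon> = \<delta>" "pull C y \<epsilon> = push C e (cls B)"
    using ET4_op[OF T presentation_etriangle[of B]] by blast
  \<comment> \<open>The composite factors through \<open>prj B\<close>, which annihilates all
    extensions. Hence \<open>etriangle_push_surj\<close> applies to this second presentation as well
    and yields \<open>r\<close>.\<close>
  have "pull C (y \<odot> prj B) (cls D) = 0"
    using pull_cmp[OF presentationD(3) T'(2) presentationD(2)]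
      pull_prj_zero[OF pull_in_Ext[OF presentationD(3) T'(2)]] by simp
  then obtain r where r: "r \<in> Hom C E (syz D)" "push C r \<epsilon> = cls D"
    using etriangle_push_surj[OF *(1) presentationD(3)] by blast
  obtain s where s: "s \<in> Hom C (syz D) E" "push C s (cls D) = \<epsilon>"
    using syz_push[OF etriangleD(3)[OF *(1)]] by blast
  show ?thesis by (rule that[OF * r s])
qed

end

section \<open>Additive functors and their shift by one degree\<close>

locale additive_functor = projectively_presented C P
  for C :: "('k::field, 'o, 'm::ab_group_add, 'e::ab_group_add) ext_cat" (structure)
    and P :: "'o \<Rightarrow> ('o, 'm, 'e) etri" +
  fixes F :: "'o \<Rightarrow> 'x::ab_group_add set" and M :: "'o \<Rightarrow> 'o \<Rightarrow> 'm \<Rightarrow> 'x \<Rightarrow> 'x"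
  assumes F_0: "0 \<in> F Z"
    and F_diff: "\<phi> \<in> F Z \<Longrightarrow> \<psi> \<in> F Z \<Longrightarrow> \<phi> - \<psi> \<in> F Z"
    and M_in: "f \<in> Hom C Z Z' \<Longrightarrow> \<phi> \<in> F Z \<Longrightarrow> M Z Z' f \<phi> \<in> F Z'"
    and M_diff: "f \<in> Hom C Z Z' \<Longrightarrow> \<phi> \<in> F Z \<Longrightarrow> \<psi> \<in> F Z \<Longrightarrow>
          M Z Z' f (\<phi> - \<psi>) = M Z Z' f \<phi> - M Z Z' f \<psi>"
    and M_diff_mor: "f \<in> Hom C Z Z' \<Longrightarrow> f' \<in> Hom C Z Z' \<Longrightarrow> \<phi> \<in> F Z \<Longrightarrow>
          M Z Z' (f - f') \<phi> = M Z Z' f \<phi> - M Z Z' f' \<phi>"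
    and M_cmp: "f \<in> Hom C Z Z' \<Longrightarrow> g \<in> Hom C Z' Z'' \<Longrightarrow> \<phi> \<in> F Z \<Longrightarrow>
          M Z Z'' (g \<odot> f) \<phi> = M Z' Z'' g (M Z Z' f \<phi>)"
    and M_idm: "\<phi> \<in> F Z \<Longrightarrow> M Z Z (idm C Z) \<phi> = \<phi>"
begin

lemma M_0: "f \<in> Hom C Z Z' \<Longrightarrow> M Z Z' f 0 = 0"
  using M_diff[OF _ F_0 F_0] by simp

lemma M_zero_mor: "\<phi> \<in> F Z \<Longrightarrow> M Z Z' 0 \<phi> = 0"
  using M_diff_mor[OF Hom_0 Hom_0] by simp

text \<open>The difference \<open>a - a'\<close> pushes \<delta> to zero, so it factors through
  \<open>x\<close>, which kills \<phi>. This is the source of all independence of choices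
  below.\<close>

lemma M_agree:
  assumes T: "etriangle C A B D x y \<delta>"
    and a: "a \<in> Hom C A U" "a' \<in> Hom C A U" "push C a \<delta> = push C a' \<delta>"
    and \<phi>: "\<phi> \<in> F A" "M A B x \<phi> = 0"
  shows "M A U a \<phi> = M A U a' \<phi>"
proof -
  note T' = etriangleD[OF T]
  have "push C (a - a') \<delta> = 0"
    using push_diff_mor[OF T'(3) a(1,2)] a(3) by simp
  then obtain b where b: "b \<in> Hom C B U" "a - a' = b \<odot> x"
    using etriangle_extend_infl[OF T Hom_diff[OF a(1,2)]] by blast
  have "M A U a \<phi> - M A U a' \<phi> = M A U (b \<odot> x) \<phi>"
    using M_diff_mor[OF a(1,2) \<phi>(1)] b(2) by simp
  also have "\<dots> = 0"
    using M_cmp[OF T'(1) b(1) \<phi>(1)] \<phi>(2) M_0[OF b(1)] by simp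
  finally show ?thesis by simp
qed

text \<open>The pair \<open>(a, d)\<close> extends to a morphism of triangles, whose middle
  component carries the vanishing of \<phi> from \<open>B\<close> to \<open>B'\<close>.\<close>

lemma M_kernel:
  assumes T: "etriangle C A B D x y \<delta>" and T2: "etriangle C A' B' D' x' y' \<delta>'"
    and a: "a \<in> Hom C A A'" and d: "d \<in> Hom C D D'" and eq: "push C a \<delta> = pull C d \<delta>'"
    and \<phi>: "\<phi> \<in> F A" "M A B x \<phi> = 0"
  shows "M A' B' x' (M A A' a \<phi>) = 0"
proof -
  obtain b where b: "b \<in> Hom C B B'" "b \<odot> x = x' \<odot> a"
    using real_mor[OF T T2 a d eq] by blast
  have "M A' B' x' (M A A' a \<phi>) = M A B' (b \<odot> x) \<phi>"
    using M_cmp[OF a etriangleD(1)[OF T2] \<phi>(1)] b(2) by simp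
  also have "\<dots> = 0"
    using M_cmp[OF etriangleD(1)[OF T] b(1) \<phi>(1)] \<phi>(2) M_0[OF b(1)] by simp
  finally show ?thesis .
qed

lemma OmegaD: "\<phi> \<in> Omega F M Z \<Longrightarrow> \<phi> \<in> F (syz Z)"
  "\<phi> \<in> Omega F M Z \<Longrightarrow> M (syz Z) (cov Z) (inc Z) \<phi> = 0"
  by (auto simp: Omega_def)

text \<open>Frees the action from the choice made in \<open>proj_lift\<close>: every lift of
  \<open>f\<close> computes it.\<close>

lemma Omega_map_lift:
  assumes f: "f \<in> Hom C Z Z'" and a: "a \<in> Hom C (syz Z) (syz Z')"
    "push C a (cls Z) = pull C f (cls Z')" and \<phi>: "\<phi> \<in> Omega F M Z"
  shows "Omega_map M Z Z' f \<phi> = M (syz Z) (syz Z') a \<phi>"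
  unfolding Omega_map_def
  by (rule M_agree[OF presentation_etriangle]) (use proj_lift[OF f] a OmegaD[OF \<phi>] in auto)

text \<open>The chosen lifts need not be additive or functorial. However, differences and composites
  of lifts are again lifts, and \<open>Omega_map_lift\<close> makes them interchangeable.\<close>

lemma additive_functor_Omega: "additive_functor C P (Omega F M) (Omega_map M)"
proof unfold_locales
  show "0 \<in> Omega F M Z" for Z
    using F_0 M_0[OF presentationD(1)] by (simp add: Omega_def)
  show "\<phi> - \<psi> \<in> Omega F M Z" if "\<phi> \<in> Omega F M Z" "\<psi> \<in> Omega F M Z" for \<phi> \<psi> Z
    using that F_diff M_diff[OF presentationD(1)] by (simp add: Omega_def)
  show "Omega_map M Z Z' f \<phi> \<in> Omega F M Z'" if f: "f \<in> Hom C Z Z'" and "\<phi> \<in> Omega F M Z"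
    for f Z Z' \<phi>
    using M_in[OF proj_lift(1)[OF f]] that(2)
      M_kernel[OF presentation_etriangle presentation_etriangle proj_lift(1)[OF f] f proj_lift(2)[OF f]]
    by (simp add: Omega_def Omega_map_def)
  show "Omega_map M Z Z' f (\<phi> - \<psi>) = Omega_map M Z Z' f \<phi> - Omega_map M Z Z' f \<psi>"
    if "f \<in> Hom C Z Z'" "\<phi> \<in> Omega F M Z" "\<psi> \<in> Omega F M Z" for f Z Z' \<phi> \<psi>
    using M_diff[OF proj_lift(1)] that by (simp add: Omega_def Omega_map_def)
  show "Omega_map M Z Z' (f - f') \<phi> = Omega_map M Z Z' f \<phi> - Omega_map M Z Z' f' \<phi>"
    if f: "f \<in> Hom C Z Z'" and f': "f' \<in> Hom C Z Z'" and \<phi>: "\<phi> \<in> Omega F M Z" for f f' Z Z' \<phi>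
  proof -
    note l = proj_lift[OF f] and l' = proj_lift[OF f']
    have "Omega_map M Z Z' (f - f') \<phi>
        = M (syz Z) (syz Z') (proj_lift C P Z Z' f - proj_lift C P Z Z' f') \<phi>"
      by (rule Omega_map_lift[OF Hom_diff[OF f f'] Hom_diff[OF l(1) l'(1)] _ \<phi>])
        (use push_diff_mor[OF presentationD(3) l(1) l'(1)]
          pull_diff_mor[OF presentationD(3) f f'] l(2) l'(2) in simp)
    then show ?thesis
      using M_diff_mor[OF l(1) l'(1) OmegaD(1)[OF \<phi>]] by (simp add: Omega_map_def)
  qed
  show "Omega_map M Z Z'' (g \<odot> f) \<phi> = Omega_map M Z' Z'' g (Omega_map M Z Z' f \<phi>)"
    if f: "f \<in> Hom C Z Z'" and g: "g \<in> Hom C Z' Z''" and \<phi>: "\<phi> \<in> Omega F M Z" for f g Z Z' Z'' \<phi>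
  proof -
    note l = proj_lift[OF f] and l' = proj_lift[OF g]
    have "push C (proj_lift C P Z' Z'' g \<odot> proj_lift C P Z Z' f) (cls Z)
        = pull C (g \<odot> f) (cls Z'')"
      using push_cmp[OF presentationD(3) l(1) l'(1)] l(2) push_pull[OF presentationD(3) l'(1) f]
        l'(2) pull_cmp[OF presentationD(3) g f] by simp
    from Omega_map_lift[OF cmp_in_Hom[OF f g] cmp_in_Hom[OF l(1) l'(1)] this \<phi>]
    show ?thesis
      using M_cmp[OF l(1) l'(1) OmegaD(1)[OF \<phi>]] by (simp add: Omega_map_def)
  qed
  show "Omega_map M Z Z (idm C Z) \<phi> = \<phi>" if \<phi>: "\<phi> \<in> Omega F M Z" for Z \<phi>
    using Omega_map_lift[OF idm_in_Hom idm_in_Hom _ \<phi>] M_idm[OF OmegaD(1)[OF \<phi>]]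
      push_idm[OF presentationD(3)] pull_idm[OF presentationD(3)] by simp
qed

text \<open>Only the nontrivial inclusion of exactness at \<open>F B\<close> is recorded; the other
  one follows from \<open>etriangle_cmp_zero\<close>.\<close>

definition exact_middle :: bool where
  "exact_middle \<longleftrightarrow> (\<forall>A B D x y \<delta> \<phi>. etriangle C A B D x y \<delta> \<longrightarrow> \<phi> \<in> F B \<longrightarrow> M B D y \<phi> = 0 \<longrightarrow>
     (\<exists>\<alpha>\<in>F A. M A B x \<alpha> = \<phi>))"

text \<open>The connecting map of a triangle with class \<open>\<delta>\<close> is induced by any \<open>t\<close> that pushes the class of
  the presentation to \<open>\<delta>\<close>.\<close>

definition exact_first :: bool where
  "exact_first \<longleftrightarrow> (\<forall>A B D x y \<delta> t \<alpha>. etriangle C A B D x y \<delta> \<longrightarrow>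
     t \<in> Hom C (syz D) A \<longrightarrow> push C t (cls D) = \<delta> \<longrightarrow> \<alpha> \<in> F A \<longrightarrow> M A B x \<alpha> = 0 \<longrightarrow>
     (\<exists>\<phi>\<in>Omega F M D. M (syz D) A t \<phi> = \<alpha>))"

definition exact_last :: bool where
  "exact_last \<longleftrightarrow> (\<forall>A B D x y \<delta> t \<phi>. etriangle C A B D x y \<delta> \<longrightarrow>
     t \<in> Hom C (syz D) A \<longrightarrow> push C t (cls D) = \<delta> \<longrightarrow> \<phi> \<in> Omega F M D \<longrightarrow> M (syz D) A t \<phi> = 0 \<longrightarrow>
     (\<exists>\<psi>\<in>Omega F M B. Omega_map M B D y \<psi> = \<phi>))"

lemma exact_middleD:
  "exact_middle \<Longrightarrow> etriangle C A B D x y \<delta> \<Longrightarrow> \<phi> \<in> F B \<Longrightarrow> M B D y \<phi> = 0 \<Longrightarrow>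
    \<exists>\<alpha>\<in>F A. M A B x \<alpha> = \<phi>"
  unfolding exact_middle_def by blast

lemma exact_firstD:
  "exact_first \<Longrightarrow> etriangle C A B D x y \<delta> \<Longrightarrow> t \<in> Hom C (syz D) A \<Longrightarrow> push C t (cls D) = \<delta> \<Longrightarrow>
    \<alpha> \<in> F A \<Longrightarrow> M A B x \<alpha> = 0 \<Longrightarrow> \<exists>\<phi>\<in>Omega F M D. M (syz D) A t \<phi> = \<alpha>"
  unfolding exact_first_def by blast

lemma exact_lastD:
  "exact_last \<Longrightarrow> etriangle C A B D x y \<delta> \<Longrightarrow> t \<in> Hom C (syz D) A \<Longrightarrow> push C t (cls D) = \<delta> \<Longrightarrow>
    \<phi> \<in> Omega F M D \<Longrightarrow> M (syz D) A t \<phi> = 0 \<Longrightarrow> \<exists>\<psi>\<in>Omega F M B. Omega_map M B D y \<psi> = \<phi>"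
  unfolding exact_last_def by blast

text \<open>Half-exactness is used for \<open>syz B -> E -> A\<close>: moved to \<open>E\<close> by
  \<open>s\<close>, the element \<phi> dies in \<open>A\<close>, so it comes from some \<psi> over
  \<open>syz B\<close>. As \<open>h e = inc B\<close>, this \<psi> lies in
  \<open>Omega F M B\<close>.\<close>

lemma exact_last_if_exact_middle:
  assumes ex: exact_middle
  shows exact_last
  unfolding exact_last_def
proof (intro allI impI)
  fix A B D x y \<delta> t \<phi>
  assume T: "etriangle C A B D x y \<delta>" and t: "t \<in> Hom C (syz D) A" "push C t (cls D) = \<delta>"
    and \<phi>: "\<phi> \<in> Omega F M D" and zero: "M (syz D) A t \<phi> = 0"
  note T' = etriangleD[OF T]
  obtain E h d e \<epsilon> r s where
    E: "etriangle C E (cov B) D h (y \<odot> prj B) \<epsilon>" "etriangle C (syz B) E A e d (pull C x (cls B))"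
      "h \<odot> e = inc B" "push C d \<epsilon> = \<delta>" "pull C y \<epsilon> = push C e (cls B)"
    and r: "r \<in> Hom C E (syz D)" "push C r \<epsilon> = cls D"
    and s: "s \<in> Hom C (syz D) E" "push C s (cls D) = \<epsilon>"
    by (rule horseshoe[OF T])
  note h = etriangleD[OF E(1)] and e = etriangleD[OF E(2)]
  note \<phi>' = OmegaD[OF \<phi>]
  define \<sigma> where "\<sigma> = M (syz D) E s \<phi>"
  have \<sigma>: "\<sigma> \<in> F E" unfolding \<sigma>_def by (rule M_in[OF s(1) \<phi>'(1)])
  have h\<sigma>: "M E (cov B) h \<sigma> = 0"
    unfolding \<sigma>_def
    by (rule M_kernel[OF presentation_etriangle E(1) s(1) idm_in_Hom _ \<phi>'])
      (use s pull_idm[OF h(3)] in simp)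
  have "M E A d \<sigma> = M (syz D) A (d \<odot> s) \<phi>"
    unfolding \<sigma>_def using M_cmp[OF s(1) e(2) \<phi>'(1)] by simp
  \<comment> \<open>Both \<open>d s\<close> and \<open>t\<close> push \<open>cls D\<close> to
    \<delta>, so they act equally on \<open>Omega F M D\<close>.\<close>
  also have "\<dots> = M (syz D) A t \<phi>"
    by (rule M_agree[OF presentation_etriangle cmp_in_Hom[OF s(1) e(2)] t(1) _ \<phi>'])
      (use push_cmp[OF presentationD(3) s(1) e(2)] s t E in simp)
  finally have "M E A d \<sigma> = 0" using zero by simp
  then obtain \<psi> where \<psi>: "\<psi> \<in> F (syz B)" "M (syz B) E e \<psi> = \<sigma>"
    using exact_middleD[OF ex E(2) \<sigma>] by blast
  have "M (syz B) (cov B) (inc B) \<psi> = 0"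
    using M_cmp[OF e(1) h(1) \<psi>(1)] E(3) \<psi>(2) h\<sigma> by simp
  then have \<psi>O: "\<psi> \<in> Omega F M B" using \<psi>(1) by (simp add: Omega_def)
  have "push C (r \<odot> e) (cls B) = pull C y (cls D)"
    using push_cmp[OF presentationD(3) e(1) r(1)] E(5) push_pull[OF h(3) r(1) T'(2)] r(2) by simp
  from Omega_map_lift[OF T'(2) cmp_in_Hom[OF e(1) r(1)] this \<psi>O]
  have "Omega_map M B D y \<psi> = M E (syz D) r \<sigma>"
    using M_cmp[OF e(1) r(1) \<psi>(1)] \<psi>(2) by simp
  also have "\<dots> = M (syz D) (syz D) (r \<odot> s) \<phi>"
    unfolding \<sigma>_def using M_cmp[OF s(1) r(1) \<phi>'(1)] by simp
  \<comment> \<open>The composite \<open>r s\<close> need not be the identity, but it fixes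
    \<open>cls D\<close> and therefore acts as the identity on \<phi>.\<close>
  also have "\<dots> = M (syz D) (syz D) (idm C (syz D)) \<phi>"
    by (rule M_agree[OF presentation_etriangle cmp_in_Hom[OF s(1) r(1)] idm_in_Hom _ \<phi>'])
      (use push_cmp[OF presentationD(3) s(1) r(1)] s r push_idm[OF presentationD(3)] in simp)
  finally show "\<exists>\<psi>\<in>Omega F M B. Omega_map M B D y \<psi> = \<phi>"
    using \<psi>O M_idm[OF \<phi>'(1)] by auto
qed

text \<open>An element killed by \<open>x\<close> must first be lifted along \<open>E -> A\<close>.
  The reason for this differs between degree zero and the higher degrees, so it is kept as the
  assumption \<open>lifts\<close>; the remaining argument is uniform.\<close>

lemma exact_first_if_lifts:
  assumes ex: exact_middle
    and lifts: "\<And>A B D E x y \<delta> e d \<alpha>. etriangle C A B D x y \<delta> \<Longrightarrow>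
      etriangle C (syz B) E A e d (pull C x (cls B)) \<Longrightarrow> \<alpha> \<in> F A \<Longrightarrow> M A B x \<alpha> = 0 \<Longrightarrow>
      \<exists>\<beta>\<in>F E. M E A d \<beta> = \<alpha>"
  shows exact_first
  unfolding exact_first_def
proof (intro allI impI)
  fix A B D x y \<delta> t \<alpha>
  assume T: "etriangle C A B D x y \<delta>" and t: "t \<in> Hom C (syz D) A" "push C t (cls D) = \<delta>"
    and \<alpha>: "\<alpha> \<in> F A" and zero: "M A B x \<alpha> = 0"
  note T' = etriangleD[OF T]
  obtain E h d e \<epsilon> r s where
    E: "etriangle C E (cov B) D h (y \<odot> prj B) \<epsilon>" "etriangle C (syz B) E A e d (pull C x (cls B))"
      "prj B \<odot> h = x \<odot> d" "h \<odot> e = inc B" "push C d \<epsilon> = \<delta>"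
    and r: "r \<in> Hom C E (syz D)" "push C r \<epsilon> = cls D"
    by (rule horseshoe[OF T])
  note h = etriangleD[OF E(1)] and e = etriangleD[OF E(2)]
  obtain \<beta> where \<beta>: "\<beta> \<in> F E" "M E A d \<beta> = \<alpha>"
    using lifts[OF T E(2) \<alpha> zero] by blast
  have "M (cov B) B (prj B) (M E (cov B) h \<beta>) = M A B x (M E A d \<beta>)"
    using M_cmp[OF h(1) presentationD(2) \<beta>(1)] M_cmp[OF e(2) T'(1) \<beta>(1)] E(3) by simp
  then have "M (cov B) B (prj B) (M E (cov B) h \<beta>) = 0" using \<beta>(2) zero by simp
  then obtain \<gamma> where \<gamma>: "\<gamma> \<in> F (syz B)" "M (syz B) (cov B) (inc B) \<gamma> = M E (cov B) h \<beta>"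
    using exact_middleD[OF ex presentation_etriangle M_in[OF h(1) \<beta>(1)]] by blast
  \<comment> \<open>Subtracting the image of \<gamma> makes the lift vanish under \<open>h\<close>,
    and its image in \<open>F A\<close> stays the same because \<open>d e = 0\<close>.\<close>
  define \<beta>' where "\<beta>' = \<beta> - M (syz B) E e \<gamma>"
  have e\<gamma>: "M (syz B) E e \<gamma> \<in> F E" by (rule M_in[OF e(1) \<gamma>(1)])
  have \<beta>': "\<beta>' \<in> F E" unfolding \<beta>'_def by (rule F_diff[OF \<beta>(1) e\<gamma>])
  have h\<beta>': "M E (cov B) h \<beta>' = 0"
    unfolding \<beta>'_def using M_diff[OF h(1) \<beta>(1) e\<gamma>] M_cmp[OF e(1) h(1) \<gamma>(1)] E(4) \<gamma>(2) by simp
  have d\<beta>': "M E A d \<beta>' = \<alpha>"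
    unfolding \<beta>'_def using M_diff[OF e(2) \<beta>(1) e\<gamma>] M_cmp[OF e(1) e(2) \<gamma>(1)]
      etriangle_cmp_zero[OF E(2)] M_zero_mor[OF \<gamma>(1)] \<beta>(2) by simp
  define \<phi> where "\<phi> = M E (syz D) r \<beta>'"
  have "M (syz D) (cov D) (inc D) \<phi> = 0"
    unfolding \<phi>_def
    by (rule M_kernel[OF E(1) presentation_etriangle r(1) idm_in_Hom _ \<beta>' h\<beta>'])
      (use r pull_idm[OF presentationD(3)] in simp)
  then have \<phi>: "\<phi> \<in> Omega F M D"
    using M_in[OF r(1) \<beta>'] by (simp add: Omega_def \<phi>_def)
  have "M (syz D) A t \<phi> = M E A (t \<odot> r) \<beta>'"
    unfolding \<phi>_def using M_cmp[OF r(1) t(1) \<beta>'] by simp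
  also have "\<dots> = M E A d \<beta>'"
    by (rule M_agree[OF E(1) cmp_in_Hom[OF r(1) t(1)] e(2) _ \<beta>' h\<beta>'])
      (use push_cmp[OF h(3) r(1) t(1)] r t E in simp)
  finally show "\<exists>\<phi>\<in>Omega F M D. M (syz D) A t \<phi> = \<alpha>"
    using \<phi> d\<beta>' by auto
qed

text \<open>The image \<sigma> of \<psi> in \<open>F E\<close> is killed by \<open>r\<close>, while
  \<open>s r\<close> fixes it, so it is zero. Exactness at the first term of
  \<open>syz B -> E -> A\<close>, whose connecting map is induced by a lift of \<open>x\<close>,
  then gives the preimage of \<psi>.\<close>

lemma exact_middle_Omega:
  assumes ex: exact_first
  shows "additive_functor.exact_middle C (Omega F M) (Omega_map M)"
  unfolding additive_functor.exact_middle_def[OF additive_functor_Omega]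
proof (intro allI impI)
  fix A B D x y \<delta> \<psi>
  assume T: "etriangle C A B D x y \<delta>" and \<psi>: "\<psi> \<in> Omega F M B"
    and zero: "Omega_map M B D y \<psi> = 0"
  note T' = etriangleD[OF T]
  obtain E h d e \<epsilon> r s where
    E: "etriangle C E (cov B) D h (y \<odot> prj B) \<epsilon>" "etriangle C (syz B) E A e d (pull C x (cls B))"
      "h \<odot> e = inc B" "pull C y \<epsilon> = push C e (cls B)"
    and r: "r \<in> Hom C E (syz D)" "push C r \<epsilon> = cls D"
    and s: "s \<in> Hom C (syz D) E" "push C s (cls D) = \<epsilon>"
    by (rule horseshoe[OF T])
  note h = etriangleD[OF E(1)] and e = etriangleD[OF E(2)]
  note \<psi>' = OmegaD[OF \<psi>]
  define \<sigma> where "\<sigma> = M (syz B) E e \<psi>"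
  have \<sigma>: "\<sigma> \<in> F E" unfolding \<sigma>_def by (rule M_in[OF e(1) \<psi>'(1)])
  have h\<sigma>: "M E (cov B) h \<sigma> = 0"
    unfolding \<sigma>_def using M_cmp[OF e(1) h(1) \<psi>'(1)] E(3) \<psi>'(2) by simp
  have "push C (r \<odot> e) (cls B) = pull C y (cls D)"
    using push_cmp[OF presentationD(3) e(1) r(1)] E(4) push_pull[OF h(3) r(1) T'(2)] r(2) by simp
  from Omega_map_lift[OF T'(2) cmp_in_Hom[OF e(1) r(1)] this \<psi>]
  have "M E (syz D) r \<sigma> = 0"
    using zero M_cmp[OF e(1) r(1) \<psi>'(1)] by (simp add: \<sigma>_def)
  moreover have "M E E (s \<odot> r) \<sigma> = M E E (idm C E) \<sigma>"
    by (rule M_agree[OF E(1) cmp_in_Hom[OF r(1) s(1)] idm_in_Hom _ \<sigma> h\<sigma>])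
      (use push_cmp[OF h(3) r(1) s(1)] s r push_idm[OF h(3)] in simp)
  ultimately have "\<sigma> = 0"
    using M_cmp[OF r(1) s(1) \<sigma>] M_0[OF s(1)] M_idm[OF \<sigma>] by simp
  then obtain \<phi> where "\<phi> \<in> Omega F M A" "M (syz A) (syz B) (proj_lift C P A B x) \<phi> = \<psi>"
    using exact_firstD[OF ex E(2) proj_lift[OF T'(1)] \<psi>'(1)] by (auto simp: \<sigma>_def)
  then show "\<exists>\<phi>\<in>Omega F M A. Omega_map M A B x \<phi> = \<psi>"
    by (auto simp: Omega_map_def)
qed

text \<open>The lifting condition one level up is \<open>exact_last\<close> for
  \<open>syz B -> E -> A\<close>, since the connecting map of that triangle is
  \<open>Omega_map M A B x\<close>.\<close>

lemma exact_first_Omega: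
  assumes last: exact_last
    and middle: "additive_functor.exact_middle C (Omega F M) (Omega_map M)"
  shows "additive_functor.exact_first C P (Omega F M) (Omega_map M)"
proof (rule additive_functor.exact_first_if_lifts[OF additive_functor_Omega middle])
  fix A B D E x y \<delta> e d \<alpha>
  assume T: "etriangle C A B D x y \<delta>" and E: "etriangle C (syz B) E A e d (pull C x (cls B))"
    and \<alpha>: "\<alpha> \<in> Omega F M A" and zero: "Omega_map M A B x \<alpha> = 0"
  show "\<exists>\<beta>\<in>Omega F M E. Omega_map M E A d \<beta> = \<alpha>"
    by (rule exact_lastD[OF last E proj_lift[OF etriangleD(1)[OF T]] \<alpha>])
      (use zero in \<open>simp add: Omega_map_def\<close>)
qed

end

section \<open>Counting along the exact sequence\<close>

context additive_functor
begin

lemma finite_Omega: "(\<And>Z. finite (F Z)) \<Longrightarrow> finite (Omega F M Z)"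
  by (simp add: Omega_def)

text \<open>The alternating product of orders is 1 along the exact sequence 0 -> K' ->
  \<open>Omega F M A\<close> -> \<open>Omega F M B\<close> -> \<open>Omega F M D\<close> -> K -> 0,
  where K' and K are the kernels of the action of \<open>x\<close> on \<open>Omega F M A\<close> and
  on \<open>F A\<close>.\<close>

lemma card_Omega_triangle:
  assumes T: "etriangle C A B D x y \<delta>"
    and fin: "\<And>Z. finite (F Z)"
    and first: exact_first and last: exact_last
    and middle: "additive_functor.exact_middle C (Omega F M) (Omega_map M)"
  shows "card (Omega F M B) * card {\<alpha> \<in> Omega F M A. Omega_map M A B x \<alpha> = 0} *
      card {\<alpha> \<in> F A. M A B x \<alpha> = 0} = card (Omega F M A) * card (Omega F M D)"
proof -
  interpret O: additive_functor C P "Omega F M" "Omega_map M" by (rule additive_functor_Omega)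
  note T' = etriangleD[OF T]
  note finO = finite_Omega[OF fin]
  obtain t where t: "t \<in> Hom C (syz D) A" "push C t (cls D) = \<delta>"
    by (rule syz_push[OF T'(3)])
  have A: "card (Omega F M A) = card (Omega_map M A B x ` Omega F M A) *
      card {\<alpha> \<in> Omega F M A. Omega_map M A B x \<alpha> = 0}"
    by (rule card_image_kernel) (use finO O.F_0 O.F_diff O.M_diff T' in auto)
  have B: "card (Omega F M B) = card (Omega_map M B D y ` Omega F M B) *
      card {\<beta> \<in> Omega F M B. Omega_map M B D y \<beta> = 0}"
    by (rule card_image_kernel) (use finO O.F_0 O.F_diff O.M_diff T' in auto)
  have D: "card (Omega F M D) = card (M (syz D) A t ` Omega F M D) *
      card {\<phi> \<in> Omega F M D. M (syz D) A t \<phi> = 0}"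
    by (rule card_image_kernel) (use finO O.F_0 O.F_diff M_diff[OF t(1)] OmegaD in auto)
  have "Omega_map M B D y (Omega_map M A B x \<alpha>) = 0" if "\<alpha> \<in> Omega F M A" for \<alpha>
    using O.M_cmp[OF T'(1,2) that] etriangle_cmp_zero[OF T] O.M_zero_mor[OF that] by simp
  then have kerB: "{\<beta> \<in> Omega F M B. Omega_map M B D y \<beta> = 0} = Omega_map M A B x ` Omega F M A"
    using O.exact_middleD[OF middle T] O.M_in[OF T'(1)] by fastforce
  have "M (syz D) A t (Omega_map M B D y \<psi>) = 0" if \<psi>: "\<psi> \<in> Omega F M B" for \<psi>
  proof -
    note l = proj_lift[OF T'(2)]
    have "M (syz D) A t (Omega_map M B D y \<psi>)
        = M (syz B) A (t \<odot> proj_lift C P B D y) \<psi>"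
      unfolding Omega_map_def using M_cmp[OF l(1) t(1) OmegaD(1)[OF \<psi>]] by simp
    \<comment> \<open>The composite of \<open>t\<close> with a lift of \<open>y\<close> pushes
      \<open>cls B\<close> to the pullback of \<delta> along \<open>y\<close>, which is zero; hence
      it acts like the zero morphism.\<close>
    also have "\<dots> = M (syz B) A 0 \<psi>"
      by (rule M_agree[OF presentation_etriangle cmp_in_Hom[OF l(1) t(1)] Hom_0 _ OmegaD[OF \<psi>]])
        (use push_cmp[OF presentationD(3) l(1) t(1)] l(2) push_pull[OF presentationD(3) t(1) T'(2)]
          t(2) etriangle_pull_zero[OF T] push_zero_mor[OF presentationD(3)] in simp)
    finally show ?thesis using M_zero_mor[OF OmegaD(1)[OF \<psi>]] by simp
  qed
  then have kerD: "{\<phi> \<in> Omega F M D. M (syz D) A t \<phi> = 0} = Omega_map M B D y ` Omega F M B"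
    using exact_lastD[OF last T t] O.M_in[OF T'(2)] by fastforce
  have "M A B x (M (syz D) A t \<phi>) = 0" if \<phi>: "\<phi> \<in> Omega F M D" for \<phi>
    by (rule M_kernel[OF presentation_etriangle T t(1) idm_in_Hom _ OmegaD[OF \<phi>]])
      (use t pull_idm[OF T'(3)] in simp)
  then have kerA: "{\<alpha> \<in> F A. M A B x \<alpha> = 0} = M (syz D) A t ` Omega F M D"
    using exact_firstD[OF first T t] M_in[OF t(1) OmegaD(1)] by fastforce
  show ?thesis
    unfolding A B D kerA kerB kerD by simp
qed

end

section \<open>The exact sequence in all degrees\<close>

context projectively_presented
begin

lemma negI_Suc: "negI C P (Suc n) U = Omega (negI C P n U) (negI_map C P n)"
  and negI_map_Suc: "negI_map C P (Suc n) = Omega_map (negI_map C P n)"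
  by (auto simp: Omega_def Omega_map_def fun_eq_iff)

lemma additive_functor_negI: "additive_functor C P (negI C P n U) (negI_map C P n)"
proof (induction n)
  case 0
  show ?case
    by unfold_locales
      (auto simp: cmp_diff_left cmp_diff_right cmp_assoc cmp_idm_left)
next
  case (Suc n)
  show ?case
    unfolding negI_Suc negI_map_Suc by (rule additive_functor.additive_functor_Omega[OF Suc])
qed

text \<open>In degree zero, \<open>x \<alpha> = 0\<close> makes \<alpha> pull the class of
  \<open>syz B -> E -> A\<close> back to zero, so \<alpha> lifts to \<open>E\<close>. In the step,
  exactness at the first term yields exactness in the middle one level up, and exactness in the
  middle yields, through \<open>exact_last\<close>, exactness at the first term one level
  up.\<close>

lemma negI_exact:
  "additive_functor.exact_middle C (negI C P n U) (negI_map C P n) \<and>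
   additive_functor.exact_first C P (negI C P n U) (negI_map C P n)"
proof (induction n)
  case 0
  note F = additive_functor_negI[of 0 U]
  have middle: "additive_functor.exact_middle C (negI C P 0 U) (negI_map C P 0)"
    unfolding additive_functor.exact_middle_def[OF F] using etriangle_lift_infl by fastforce
  have "additive_functor.exact_first C P (negI C P 0 U) (negI_map C P 0)"
  proof (rule additive_functor.exact_first_if_lifts[OF F middle])
    fix A B D E x y \<delta> e d \<alpha>
    assume T: "etriangle C A B D x y \<delta>" and E: "etriangle C (syz B) E A e d (pull C x (cls B))"
      and \<alpha>: "\<alpha> \<in> negI C P 0 U A" and zero: "negI_map C P 0 A B x \<alpha> = 0"
    have \<alpha>': "\<alpha> \<in> Hom C U A" using \<alpha> by simp
    have "pull C \<alpha> (pull C x (cls B)) = 0"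
      using pull_cmp[OF presentationD(3) etriangleD(1)[OF T] \<alpha>'] zero
        pull_zero_mor[OF presentationD(3)] by simp
    then show "\<exists>\<beta>\<in>negI C P 0 U E. negI_map C P 0 E A d \<beta> = \<alpha>"
      using etriangle_lift_defl[OF E \<alpha>'] by auto
  qed
  with middle show ?case by blast
next
  case (Suc n)
  note F = additive_functor_negI[of n U]
  have middle: "additive_functor.exact_middle C (negI C P (Suc n) U) (negI_map C P (Suc n))"
    unfolding negI_Suc negI_map_Suc
    by (rule additive_functor.exact_middle_Omega[OF F]) (use Suc in blast)
  moreover have "additive_functor.exact_first C P (negI C P (Suc n) U) (negI_map C P (Suc n))"
    unfolding negI_Suc negI_map_Suc
    by (rule additive_functor.exact_first_Omega[OF F
          additive_functor.exact_last_if_exact_middle[OF F]])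
      (use Suc middle in \<open>auto simp: negI_Suc negI_map_Suc simp del: negI.simps negI_map.simps\<close>)
  ultimately show ?case by blast
qed

end

section \<open>Alternating products\<close>

text \<open>Each \<open>k n\<close> occurs in two consecutive instances of \<open>rec\<close> with
  opposite exponents, so only \<open>k 0\<close> survives; \<open>ev\<close> reduces the infinite
  products to finite ones.\<close>

lemma prodinf_alternating_telescope:
  fixes a b d k :: "nat \<Rightarrow> real"
  assumes pos: "\<And>n. 0 < a n" "\<And>n. 0 < b n" "\<And>n. 0 < d n" "\<And>n. 0 < k n"
    and rec: "\<And>n. b (Suc n) * k (Suc n) * k n = a (Suc n) * d (Suc n)"
    and ev: "\<And>n. N \<le> n \<Longrightarrow> a n = 1 \<and> b n = 1 \<and> d n = 1 \<and> k n = 1"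
  shows "prodinf (\<lambda>i. b (Suc i) powi ((- 1) ^ Suc i)) =
    k 0 * prodinf (\<lambda>i. a (Suc i) powi ((- 1) ^ Suc i)) *
      prodinf (\<lambda>i. d (Suc i) powi ((- 1) ^ Suc i))"
proof -
  \<comment> \<open>A truncated product leaves one boundary factor \<open>k n\<close>, which is 1 at
    \<open>n = N\<close>.\<close>
  have partial: "(\<Prod>i<n. b (Suc i) powi ((- 1) ^ Suc i)) * k n powi ((- 1) ^ n) =
      k 0 * (\<Prod>i<n. a (Suc i) powi ((- 1) ^ Suc i)) * (\<Prod>i<n. d (Suc i) powi ((- 1) ^ Suc i))" for n
  proof (induction n)
    case (Suc n)
    have b: "b (Suc n) = a (Suc n) * d (Suc n) / (k (Suc n) * k n)"
      using rec[of n] pos(4)[of n] pos(4)[of "Suc n"] by (simp add: field_simps)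
    have "b (Suc n) powi ((- 1) ^ Suc n) * k (Suc n) powi ((- 1) ^ Suc n) =
        k n powi ((- 1) ^ n) * (a (Suc n) powi ((- 1) ^ Suc n) * d (Suc n) powi ((- 1) ^ Suc n))"
    proof (cases "even n")
      case True
      then show ?thesis
        unfolding b using pos(1,3)[of "Suc n"] pos(4)[of n] pos(4)[of "Suc n"]
        by (simp add: power_int_minus field_simps)
    next
      case False
      then show ?thesis
        unfolding b using pos(1,3)[of "Suc n"] pos(4)[of n] pos(4)[of "Suc n"]
        by (simp add: power_int_minus field_simps)
    qed
    with Suc.IH show ?case
      by (simp add: mult_ac) (metis (no_types, lifting) mult.assoc mult.left_commute)
  qed simp
  have eq: "prodinf (\<lambda>i. c (Suc i) powi ((- 1) ^ Suc i)) = (\<Prod>i<N. c (Suc i) powi ((- 1) ^ Suc i))"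
    if "\<And>n. N \<le> n \<Longrightarrow> c n = 1" for c :: "nat \<Rightarrow> real"
    by (rule prodinf_finite) (use that in auto)
  show ?thesis
    using partial[of N] ev eq[of a] eq[of b] eq[of d] by simp
qed

section \<open>Finiteness of the spaces and of the total dimension\<close>

lemma finite_if_fin_dim:
  fixes C :: "('k::{field,finite}, 'o, 'm::ab_group_add, 'e) ext_cat"
  assumes vs: "vector_space (scale C)" and fin: "fin_dim C V"
  shows "finite V"
proof -
  interpret vector_space "scale C" by (rule vs)
  obtain B where B: "finite B" "V \<subseteq> span B"
    using fin unfolding fin_dim_def by blast
  have "finite (span B)"
    using B(1)
  proof (induction B)
    case (insert b B)
    have "span (insert b B) \<subseteq> (\<lambda>(c, v). scale C c b + v) ` (UNIV \<times> span B)"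
      unfolding span_insert by (auto simp: image_iff) (metis add_diff_cancel_left' diff_add_cancel)
    then show ?case
      using insert.IH by (meson finite_SigmaI finite_UNIV finite_imageI finite_subset finite)
  qed simp
  with B(2) show ?thesis by (rule finite_subset)
qed

text \<open>The terms of a summable series tend to zero, and dimensions are natural numbers, so they
  are eventually zero.\<close>

lemma fin_total_dim_eventually_trivial:
  fixes C :: "('k::{field,finite}, 'o, 'm::ab_group_add, 'e) ext_cat"
  assumes vs: "vector_space (scale C)" and fin: "fin_total_dim C V" and zero: "\<And>n. 0 \<in> V n"
  shows "\<exists>N. \<forall>n\<ge>N. V n = {0}"
proof -
  interpret vector_space "scale C" by (rule vs)
  have "(\<lambda>n. real (dim (V n))) \<longlonglongrightarrow> 0"
    using fin unfolding fin_total_dim_def by (blast intro: summable_LIMSEQ_zero)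
  then have "eventually (\<lambda>n. real (dim (V n)) < 1) sequentially"
    by (rule order_tendstoD) simp
  then obtain N where N: "\<And>n. N \<le> n \<Longrightarrow> dim (V n) = 0"
    by (auto simp: eventually_sequentially)
  have "V n = {0}" if n: "n \<ge> N" for n
  proof -
    \<comment> \<open>Finiteness is what turns \<open>card B = 0\<close> into an empty basis, as
      infinite sets have \<open>card\<close> zero too.\<close>
    have "finite (V n)"
      using fin finite_if_fin_dim[OF vs] unfolding fin_total_dim_def by blast
    then obtain B where "B \<subseteq> V n" "V n \<subseteq> span B" "card B = 0" "finite B"
      using basis_exists[of "V n"] N[OF n] finite_subset by metis
    then show ?thesis using zero[of n] by auto
  qed
  then show ?thesis by blast
qed

section \<open>Multiplicativity of brackets along a triangle\<close>

locale finite_projectively_presented = projectively_presented C P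
  for C :: "('k::{field,finite}, 'o, 'm::ab_group_add, 'e::ab_group_add) ext_cat" (structure)
    and P :: "'o \<Rightarrow> ('o, 'm, 'e) etri" +
  assumes fin_total_dim_negI: "fin_total_dim C (\<lambda>n. negI C P n U V)"
begin

lemma finite_negI: "finite (negI C P n U V)"
  using fin_total_dim_negI finite_if_fin_dim[OF scale_vector_space]
  unfolding fin_total_dim_def by blast

lemma finite_Hom: "finite (Hom C U V)"
  using finite_negI[of 0] by simp

lemma zero_in_negI: "0 \<in> negI C P n U V"
  by (rule additive_functor.F_0[OF additive_functor_negI])

lemma card_negI_pos: "0 < card (negI C P n U V)"
  using finite_negI zero_in_negI by (metis card_gt_0_iff empty_iff)

lemma brI_pos: "0 < brI C P U V"
proof -
  obtain N where "\<And>n. N \<le> n \<Longrightarrow> negI C P n U V = {0}"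
    using fin_total_dim_eventually_trivial[OF scale_vector_space fin_total_dim_negI zero_in_negI]
    by blast
  then have "brI C P U V =
      (\<Prod>i<N. real (card (negI C P (Suc i) U V)) powi ((- 1) ^ Suc i))"
    unfolding brI_def alt_card_def by (intro prodinf_finite) (auto simp del: negI.simps)
  then show ?thesis
    using card_negI_pos by (auto intro!: prod_pos zero_less_power_int simp del: negI.simps)
qed

text \<open>With \<open>k n\<close> the order of the kernel of \<open>x\<close> in degree
  \<open>-n\<close>, the exact sequence gives the telescoping recurrence; the surviving
  \<open>k 0\<close> is the kernel on Hom.\<close>

lemma brI_triangle:
  assumes T: "etriangle C A B D x y \<delta>"
  shows "brI C P U B = card {\<phi> \<in> Hom C U A. x \<odot> \<phi> = 0} * brI C P U A * brI C P U D"
proof -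
  define k where "k n = card {\<phi> \<in> negI C P n U A. negI_map C P n A B x \<phi> = 0}" for n
  have "0 \<in> {\<phi> \<in> negI C P n U A. negI_map C P n A B x \<phi> = 0}" for n
    using zero_in_negI additive_functor.M_0[OF additive_functor_negI etriangleD(1)[OF T]] by simp
  then have kpos: "0 < k n" for n
    unfolding k_def using finite_negI by (auto simp: card_gt_0_iff)
  have kle: "k n \<le> card (negI C P n U A)" for n
    unfolding k_def by (rule card_mono[OF finite_negI]) auto
  have rec: "card (negI C P (Suc n) U B) * k (Suc n) * k n =
      card (negI C P (Suc n) U A) * card (negI C P (Suc n) U D)" for n
  proof -
    note F = additive_functor_negI[of n U]
    show ?thesis
      unfolding k_def negI_Suc negI_map_Suc
      by (rule additive_functor.card_Omega_triangle[OF F T finite_negI])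
        (use negI_exact[of n U] negI_exact[of "Suc n" U]
            additive_functor.exact_last_if_exact_middle[OF F]
          in \<open>auto simp: negI_Suc negI_map_Suc simp del: negI.simps negI_map.simps\<close>)
  qed
  have "\<exists>N. \<forall>n\<ge>N. negI C P n U V = {0}" for V
    by (rule fin_total_dim_eventually_trivial[OF scale_vector_space fin_total_dim_negI zero_in_negI])
  then obtain N where N: "negI C P n U V = {0}" if "n \<ge> N V" for V n
    by metis
  define N' where "N' = N A + N B + N D"
  have triv: "card (negI C P n U A) = 1 \<and> card (negI C P n U B) = 1 \<and> card (negI C P n U D) = 1 \<and>
      k n = 1" if "N' \<le> n" for n
  proof -
    have "card (negI C P n U A) = 1" using N[of A n] that by (simp add: N'_def)
    with N[of B n] N[of D n] that kpos[of n] kle[of n] show ?thesis by (simp add: N'_def)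
  qed
  have "brI C P U B = k 0 * brI C P U A * brI C P U D"
    unfolding brI_def alt_card_def
  proof (rule prodinf_alternating_telescope[where N = N'])
    show "real (card (negI C P (Suc n) U B)) * real (k (Suc n)) * real (k n) =
        real (card (negI C P (Suc n) U A)) * real (card (negI C P (Suc n) U D))" for n
      using rec[of n] by (metis of_nat_mult)
  qed (use kpos card_negI_pos triv in \<open>simp_all del: negI.simps\<close>)
  then show ?thesis by (simp add: k_def)
qed

end

section \<open>The opposite category\<close>

text \<open>Reversal exchanges projective and injective presentations, so type II statements and
  duals of lemmas on triangles follow from their counterparts.\<close>

definition op_cat :: "('k, 'o, 'm, 'e) ext_cat \<Rightarrow> ('k, 'o, 'm, 'e) ext_cat" where
  "op_cat C = \<lparr>scale = scale C, Hom = (\<lambda>X Y. Hom C Y X), idm = idm C, cmp = (\<lambda>g f. f \<odot>\<^bsub>C\<^esub> g),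
     Ext = (\<lambda>D A. Ext C A D), push = pull C, pull = push C,
     realization = (\<lambda>D A \<delta>. {(B, x, y). (B, y, x) \<in> realization C A D \<delta>})\<rparr>"

lemma op_cat_simps [simp]:
  "scale (op_cat C) = scale C" "Hom (op_cat C) X Y = Hom C Y X" "idm (op_cat C) = idm C"
  "cmp (op_cat C) g f = f \<odot>\<^bsub>C\<^esub> g" "Ext (op_cat C) D A = Ext C A D"
  "push (op_cat C) = pull C" "pull (op_cat C) = push C"
  by (simp_all add: op_cat_def)

lemma etriangle_op [simp]: "etriangle (op_cat C) A B D x y \<delta> \<longleftrightarrow> etriangle C D B A y x \<delta>"
  by (simp add: etriangle_def op_cat_def)

lemma iso_mor_op [simp]: "iso_mor (op_cat C) X Y f \<longleftrightarrow> iso_mor C Y X f"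
  by (auto simp: iso_mor_def)

lemma Aut_op [simp]: "Aut (op_cat C) X = Aut C X"
  by (simp add: Aut_def)

lemma zero_object_op [simp]: "zero_object (op_cat C) Z \<longleftrightarrow> zero_object C Z"
  by (auto simp: zero_object_def)

lemma biproduct_op [simp]: "biproduct (op_cat C) A B S i j p q \<longleftrightarrow> biproduct C A B S p q i j"
  by (auto simp: biproduct_def)

lemma biproduct_swap: "biproduct C A B S i j p q \<Longrightarrow> biproduct C B A S j i q p"
  by (auto simp: biproduct_def add.commute)

lemma (in linear_category) isomorphic_sym: "isomorphic C X Y \<Longrightarrow> isomorphic C Y X"
  unfolding isomorphic_def iso_mor_def by blast

lemma (in linear_category) isomorphic_op: "isomorphic (op_cat C) X Y \<longleftrightarrow> isomorphic C X Y"
  using isomorphic_sym by (auto simp: isomorphic_def)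

lemma op_cat_op_cat [simp]: "op_cat (op_cat C) = (C :: ('k, 'o, 'm, 'e) ext_cat)"
  by (cases C) (simp add: op_cat_def)

lemma (in linear_category) linear_category_op: "linear_category (op_cat C)"
  by (rule linear_category.intro) (auto simp: scale_vector_space Hom_subspace cmp_idm_left cmp_idm_right
      cmp_assoc cmp_add_left cmp_add_right cmp_scale_left cmp_scale_right)

text \<open>Reversing arrows also reverses the comparison of middle terms, so its inverse serves as
  witness.\<close>

lemma (in linear_category) seq_equiv_opI:
  assumes "seq_equiv C D A (B, y, x) (B', y', x')"
  shows "seq_equiv (op_cat C) A D (B, x, y) (B', x', y')"
proof -
  obtain b where b: "x \<in> Hom C B A" "y \<in> Hom C D B" "x' \<in> Hom C B' A" "y' \<in> Hom C D B'"
    "iso_mor C B B' b" "b \<odot> y = y'" "x' \<odot> b = x"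
    using assms by (auto simp: seq_equiv_def)
  obtain c where c: "b \<in> Hom C B B'" "c \<in> Hom C B' B" "c \<odot> b = idm C B"
    "b \<odot> c = idm C B'" "iso_mor C B' B c"
    by (rule iso_mor_inverse[OF b(5)])
  have "x \<odot> c = x'"
    using cmp_assoc[OF c(2) c(1) b(3)] c(4) cmp_idm_right[OF b(3)] b(7) by simp
  moreover have "c \<odot> y' = y"
    using cmp_assoc[OF b(2) c(1,2)] c(3) cmp_idm_left[OF b(2)] b(6) by simp
  ultimately show ?thesis using b c(5) by (auto simp: seq_equiv_def)
qed

lemma (in linear_category) seq_equiv_op:
  "seq_equiv (op_cat C) A D (B, x, y) (B', x', y') \<longleftrightarrow> seq_equiv C D A (B, y, x) (B', y', x')"
  using seq_equiv_opI linear_category.seq_equiv_opI[OF linear_category_op] by fastforce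

text \<open>(ET3) and (ET4) trade places with their duals. Extra work arises for
  \<open>real_class\<close>, where equivalences of sequences are reversed, and for
  \<open>real_sum\<close>, where composites are rebracketed and push and pull commuted.\<close>

lemma (in extriangulated_category) extriangulated_category_op: "extriangulated_category (op_cat C)"
proof -
  interpret op: linear_category "op_cat C" by (rule linear_category_op)
  show ?thesis
  proof unfold_locales
    show "\<exists>Z. zero_object (op_cat C) Z" using zero_object_exists by simp
    show "\<exists>S i j p q. biproduct (op_cat C) A B S i j p q" for A B
      using biproduct_exists[of A B] unfolding biproduct_op by blast
    show "\<exists>B x y. x \<in> Hom (op_cat C) A B \<and> y \<in> Hom (op_cat C) B D \<and>
        realization (op_cat C) D A \<delta> = Collect (seq_equiv (op_cat C) A D (B, x, y))"
      if "\<delta> \<in> Ext (op_cat C) D A" for \<delta> D A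
    proof -
      have "\<delta> \<in> Ext C A D" using that by simp
      from real_class[OF this] obtain B x y where *: "x \<in> Hom C D B" "y \<in> Hom C B A"
          "realization C A D \<delta> = Collect (seq_equiv C D A (B, x, y))"
        by blast
      have "realization (op_cat C) D A \<delta> = Collect (seq_equiv (op_cat C) A D (B, y, x))"
        by (auto simp: op_cat_def *(3) seq_equiv_op[unfolded op_cat_def])
      with * show ?thesis by auto
    qed
    show "\<exists>b\<in>Hom (op_cat C) B B'. cmp (op_cat C) b x = cmp (op_cat C) x' a \<and>
        cmp (op_cat C) y' b = cmp (op_cat C) d y"
      if "etriangle (op_cat C) A B D x y \<delta>" "etriangle (op_cat C) A' B' D' x' y' \<delta>'"
        "a \<in> Hom (op_cat C) A A'" "d \<in> Hom (op_cat C) D D'"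
        "push (op_cat C) a \<delta> = pull (op_cat C) d \<delta>'"
      for A B D x y \<delta> A' B' D' x' y' \<delta>' a d
      using real_mor[of D' B' A' y' x' \<delta>' D B A y x \<delta> d a] that by auto
    show "etriangle (op_cat C) SA SB SD
        (cmp (op_cat C) iB (cmp (op_cat C) x pA) + cmp (op_cat C) jB (cmp (op_cat C) x' qA))
        (cmp (op_cat C) iD (cmp (op_cat C) y pB) + cmp (op_cat C) jD (cmp (op_cat C) y' qB))
        (push (op_cat C) iA (pull (op_cat C) pD \<delta>) + push (op_cat C) jA (pull (op_cat C) qD \<delta>'))"
      if T: "etriangle (op_cat C) A B D x y \<delta>" and T': "etriangle (op_cat C) A' B' D' x' y' \<delta>'"
        and S: "biproduct (op_cat C) A A' SA iA jA pA qA" "biproduct (op_cat C) B B' SB iB jB pB qB"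
          "biproduct (op_cat C) D D' SD iD jD pD qD"
      for A B D x y \<delta> A' B' D' x' y' \<delta>' SA SB SD iA jA pA qA iB jB pB qB iD jD pD qD
    proof -
      note t = etriangleD[OF T[simplified]] and t' = etriangleD[OF T'[simplified]]
      have s: "iA \<in> Hom C SA A" "jA \<in> Hom C SA A'" "pA \<in> Hom C A SA" "qA \<in> Hom C A' SA"
          "iB \<in> Hom C SB B" "jB \<in> Hom C SB B'" "pB \<in> Hom C B SB" "qB \<in> Hom C B' SB"
          "iD \<in> Hom C SD D" "jD \<in> Hom C SD D'" "pD \<in> Hom C D SD" "qD \<in> Hom C D' SD"
        using S by (auto simp: biproduct_def)
      have "etriangle C SD SB SA (pB \<odot> y \<odot> iD + qB \<odot> y' \<odot> jD) (pA \<odot> x \<odot> iB + qA \<odot> x' \<odot> jB)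
          (push C pD (pull C iA \<delta>) + push C qD (pull C jA \<delta>'))"
        by (rule real_sum) (use T T' S in auto)
      then show ?thesis
        using cmp_assoc[OF s(9) t(1) s(7)] cmp_assoc[OF s(10) t'(1) s(8)]
          cmp_assoc[OF s(5) t(2) s(3)] cmp_assoc[OF s(6) t'(2) s(4)]
          push_pull[OF t(3) s(11) s(1)] push_pull[OF t'(3) s(12) s(2)]
        by simp
    qed
    show "\<exists>d\<in>Hom (op_cat C) D D'. cmp (op_cat C) d y = cmp (op_cat C) y' b \<and>
        push (op_cat C) a \<delta> = pull (op_cat C) d \<delta>'"
      if "etriangle (op_cat C) A B D x y \<delta>" "etriangle (op_cat C) A' B' D' x' y' \<delta>'"
        "a \<in> Hom (op_cat C) A A'" "b \<in> Hom (op_cat C) B B'"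
        "cmp (op_cat C) b x = cmp (op_cat C) x' a"
      for A B D x y \<delta> A' B' D' x' y' \<delta>' a b
      using ET3_op[of D' B' A' y' x' \<delta>' D B A y x \<delta> b a] that by auto
    show "\<exists>a\<in>Hom (op_cat C) A A'. cmp (op_cat C) b x = cmp (op_cat C) x' a \<and>
        push (op_cat C) a \<delta> = pull (op_cat C) d \<delta>'"
      if "etriangle (op_cat C) A B D x y \<delta>" "etriangle (op_cat C) A' B' D' x' y' \<delta>'"
        "b \<in> Hom (op_cat C) B B'" "d \<in> Hom (op_cat C) D D'"
        "cmp (op_cat C) d y = cmp (op_cat C) y' b"
      for A B D x y \<delta> A' B' D' x' y' \<delta>' b d
      using ET3[of D' B' A' y' x' \<delta>' D B A y x \<delta> d b] that by simp metis
    show "\<exists>E h' d e \<delta>''. etriangle (op_cat C) A M E (cmp (op_cat C) g f) h' \<delta>'' \<and>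
        etriangle (op_cat C) D E F d e (push (op_cat C) f' \<delta>') \<and>
        cmp (op_cat C) h' g = cmp (op_cat C) d f' \<and> cmp (op_cat C) e h' = g' \<and>
        pull (op_cat C) d \<delta>'' = \<delta> \<and> push (op_cat C) f \<delta>'' = pull (op_cat C) e \<delta>'"
      if "etriangle (op_cat C) A B D f f' \<delta>" "etriangle (op_cat C) B M F g g' \<delta>'"
      for A B D f f' \<delta> M F g g' \<delta>'
      using ET4_op[of D B A f' f \<delta> F M g' g \<delta>'] that by simp
    show "\<exists>E h' d e \<delta>''. etriangle (op_cat C) E M A h' (cmp (op_cat C) f g) \<delta>'' \<and>
        etriangle (op_cat C) F E D e d (pull (op_cat C) f' \<delta>') \<and>
        cmp (op_cat C) g h' = cmp (op_cat C) f' d \<and> cmp (op_cat C) h' e = g' \<and>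
        push (op_cat C) d \<delta>'' = \<delta> \<and> pull (op_cat C) f \<delta>'' = push (op_cat C) e \<delta>'"
      if "etriangle (op_cat C) D B A f' f \<delta>" "etriangle (op_cat C) F M B g' g \<delta>'"
      for D B A f' f \<delta> F M g' g \<delta>'
      using ET4[of A B D f f' \<delta> M F g g' \<delta>'] that by simp
  qed (auto simp: Ext_zero Ext_add Ext_uminus push_in_Ext pull_in_Ext push_add pull_add push_idm
      pull_idm push_cmp pull_cmp push_pull push_add_mor pull_add_mor intro: real_zero biproduct_swap)
qed

section \<open>Type II negative extensions as type I in the opposite category\<close>

definition op_etri :: "('o, 'm, 'e) etri \<Rightarrow> ('o, 'm, 'e) etri" where
  "op_etri T = \<lparr>fst_ob = lst_ob T, mid_ob = mid_ob T, lst_ob = fst_ob T, infl = defl T,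
     defl = infl T, ext_class = ext_class T\<rparr>"

lemma op_etri_simps [simp]:
  "fst_ob (op_etri T) = lst_ob T" "mid_ob (op_etri T) = mid_ob T" "lst_ob (op_etri T) = fst_ob T"
  "infl (op_etri T) = defl T" "defl (op_etri T) = infl T" "ext_class (op_etri T) = ext_class T"
  by (simp_all add: op_etri_def)

lemma projective_presentations_op:
  "projective_presentations (op_cat C) (\<lambda>Z. op_etri (J Z)) \<longleftrightarrow> injective_presentations C J"
  by (auto simp: projective_presentations_def injective_presentations_def etri_in_def
      projective_mor_def injective_mor_def)

text \<open>The predicates under \<open>SOME\<close> coincide, so the chosen lifts are equal and not
  merely interchangeable.\<close>

lemma proj_lift_op: "proj_lift (op_cat C) (\<lambda>Z. op_etri (J Z)) Z' Z f = inj_lift C J Z Z' f"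
  unfolding proj_lift_def inj_lift_def by (rule arg_cong[of _ _ Eps]) auto

lemma negI_map_op:
  "negI_map (op_cat C) (\<lambda>Z. op_etri (J Z)) n Z' Z f \<phi> = negII_map C J n Z Z' f \<phi>"
  by (induction n arbitrary: Z Z' f) (simp_all add: proj_lift_op)

lemma negI_op: "negI (op_cat C) (\<lambda>Z. op_etri (J Z)) n X Z = negII C J n Z X"
  by (induction n arbitrary: Z) (simp_all add: negI_map_op)

lemma brI_op: "brI (op_cat C) (\<lambda>Z. op_etri (J Z)) X Y = brII C J Y X"
  by (simp add: brI_def brII_def negI_op)

section \<open>Automorphisms of triangles\<close>

context extriangulated_category
begin

text \<open>The difference \<open>u\<close> of \<open>c\<close> and the identity kills
  \<open>y\<close> and pulls \<delta> back to zero, so it factors through \<open>y\<close> and has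
  square zero.\<close>

lemma etriangle_endo_last_Aut:
  assumes T: "etriangle C A B D x y \<delta>" and c: "c \<in> Hom C D D" "c \<odot> y = y" "pull C c \<delta> = \<delta>"
  shows "c \<in> Aut C D"
proof -
  note T' = etriangleD[OF T]
  define u where "u = c - idm C D"
  have u: "u \<in> Hom C D D" using c by (auto simp: u_def)
  have uy: "u \<odot> y = 0"
    unfolding u_def using cmp_diff_left[OF T'(2) c(1) idm_in_Hom] c(2) cmp_idm_left[OF T'(2)] by simp
  have "pull C u \<delta> = 0"
    unfolding u_def using pull_diff_mor[OF T'(3) c(1) idm_in_Hom] c(3) pull_idm[OF T'(3)] by simp
  then obtain w where w: "w \<in> Hom C D B" "u = y \<odot> w"
    using etriangle_lift_defl[OF T u] by blast
  have "u \<odot> u = (u \<odot> y) \<odot> w" using cmp_assoc[OF w(1) T'(2) u] w(2) by simp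
  then have "u \<odot> u = 0" using uy cmp_0_left[OF w(1)] by simp
  from iso_idm_add_square_zero[OF u this] show ?thesis by (simp add: u_def)
qed

lemma etriangle_endo_mid_Aut:
  assumes T: "etriangle C A B D x y \<delta>" and b: "b \<in> Hom C B B" "b \<odot> x = x" "y \<odot> b = y"
  shows "b \<in> Aut C B"
proof -
  note T' = etriangleD[OF T]
  define u where "u = b - idm C B"
  have u: "u \<in> Hom C B B" using b by (auto simp: u_def)
  have ux: "u \<odot> x = 0"
    unfolding u_def using cmp_diff_left[OF T'(1) b(1) idm_in_Hom] b(2) cmp_idm_left[OF T'(1)] by simp
  have "y \<odot> u = 0"
    unfolding u_def using cmp_diff_right[OF b(1) idm_in_Hom T'(2)] b(3) cmp_idm_right[OF T'(2)] by simp
  then obtain w where w: "w \<in> Hom C B A" "u = x \<odot> w"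
    using etriangle_lift_infl[OF T u] by blast
  have "u \<odot> u = (u \<odot> x) \<odot> w" using cmp_assoc[OF w(1) T'(1) u] w(2) by simp
  then have "u \<odot> u = 0" using ux cmp_0_left[OF w(1)] by simp
  from iso_idm_add_square_zero[OF u this] show ?thesis by (simp add: u_def)
qed

text \<open>The class is transported along the inverse of \<open>c\<close> and realized by some
  \<open>B'\<close>; comparing \<open>B\<close> with \<open>B'\<close> in both directions gives
  endomorphisms fixing both maps, hence units.\<close>

lemma etriangle_iso_last:
  assumes T: "etriangle C A B D x y \<delta>" and c: "iso_mor C D D' c"
  shows "\<exists>\<delta>'. etriangle C A B D' x (c \<odot> y) \<delta>'"
proof -
  note T' = etriangleD[OF T]
  obtain c' where c': "c \<in> Hom C D D'" "c' \<in> Hom C D' D" "c' \<odot> c = idm C D" "c \<odot> c' = idm C D'"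
    by (rule iso_mor_inverse[OF c])
  define \<delta>' where "\<delta>' = pull C c' \<delta>"
  have \<delta>': "\<delta>' \<in> Ext C D' A" unfolding \<delta>'_def by (rule pull_in_Ext[OF T'(3) c'(2)])
  obtain B' x' y' where R: "etriangle C A B' D' x' y' \<delta>'"
    using etriangle_exists[OF \<delta>'] by blast
  note R' = etriangleD[OF R]
  have "push C (idm C A) \<delta> = pull C c \<delta>'"
    unfolding \<delta>'_def using pull_cmp[OF T'(3) c'(2,1)] c'(3) pull_idm[OF T'(3)] push_idm[OF T'(3)]
    by simp
  then obtain b where b: "b \<in> Hom C B B'" "b \<odot> x = x'" "y' \<odot> b = c \<odot> y"
    using real_mor[OF T R idm_in_Hom c'(1)] cmp_idm_right[OF R'(1)] by auto
  have "push C (idm C A) \<delta>' = pull C c' \<delta>"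
    using push_idm[OF \<delta>'] by (simp add: \<delta>'_def)
  then obtain b' where b': "b' \<in> Hom C B' B" "b' \<odot> x' = x" "y \<odot> b' = c' \<odot> y'"
    using real_mor[OF R T idm_in_Hom c'(2)] cmp_idm_right[OF T'(1)] by auto
  have "b' \<odot> b \<in> Aut C B"
  proof (rule etriangle_endo_mid_Aut[OF T cmp_in_Hom[OF b(1) b'(1)]])
    show "(b' \<odot> b) \<odot> x = x" using cmp_assoc[OF T'(1) b(1) b'(1)] b b' by simp
    have "y \<odot> (b' \<odot> b) = c' \<odot> (y' \<odot> b)"
      using cmp_assoc[OF b(1) b'(1) T'(2)] cmp_assoc[OF b(1) R'(2) c'(2)] b' by simp
    then show "y \<odot> (b' \<odot> b) = y"
      using cmp_assoc[OF T'(2) c'(1,2)] c'(3) cmp_idm_left[OF T'(2)] b(3) by simp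
  qed
  moreover have "b \<odot> b' \<in> Aut C B'"
  proof (rule etriangle_endo_mid_Aut[OF R cmp_in_Hom[OF b'(1) b(1)]])
    show "(b \<odot> b') \<odot> x' = x'" using cmp_assoc[OF R'(1) b'(1) b(1)] b b' by simp
    have "y' \<odot> (b \<odot> b') = c \<odot> (y \<odot> b')"
      using cmp_assoc[OF b'(1) b(1) R'(2)] cmp_assoc[OF b'(1) T'(2) c'(1)] b by simp
    then show "y' \<odot> (b \<odot> b') = y'"
      using cmp_assoc[OF R'(2) c'(2,1)] c'(4) cmp_idm_left[OF R'(2)] b'(3) by simp
  qed
  ultimately have "iso_mor C B B' b" by (rule iso_morI_Aut[OF b(1) b'(1)])
  \<comment> \<open>The map \<open>b'\<close> need not be inverse to \<open>b\<close>; the true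
    inverse carries the realization back to \<open>B\<close>.\<close>
  then obtain b0 where b0: "b0 \<in> Hom C B' B" "b0 \<odot> b = idm C B" "b \<odot> b0 = idm C B'"
      "iso_mor C B' B b0"
    by (rule iso_mor_inverse)
  have "(c \<odot> y) \<odot> b0 = y'"
    using cmp_assoc[OF b0(1) b(1) R'(2)] b(3) b0(3) cmp_idm_right[OF R'(2)] by simp
  moreover have "b0 \<odot> x' = x"
    using cmp_assoc[OF T'(1) b(1) b0(1)] b(2) b0(2) cmp_idm_left[OF T'(1)] by simp
  ultimately show ?thesis
    using etriangle_equiv[OF R b0(4) cmp_in_Hom[OF T'(2) c'(1)]] by auto
qed

text \<open>(ET3) in both directions gives maps between the cones whose composites fix the deflation
  and the class, hence are automorphisms.\<close>

lemma etriangle_infl_unique: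
  assumes T: "etriangle C A B D x y \<delta>" and R: "etriangle C A B D' x y' \<delta>'"
  shows "\<exists>c. iso_mor C D D' c \<and> c \<odot> y = y'"
proof -
  have *: "\<exists>c\<in>Hom C D D'. c \<odot> y = y' \<and> pull C c \<delta>' = \<delta>"
    if T: "etriangle C A B D x y \<delta>" and R: "etriangle C A B D' x y' \<delta>'" for D y \<delta> D' y' \<delta>'
  proof -
    note T' = etriangleD[OF T] and R' = etriangleD[OF R]
    show ?thesis
      using ET3[OF T R idm_in_Hom idm_in_Hom] cmp_idm_left[OF T'(1)] cmp_idm_right[OF T'(1)]
        cmp_idm_right[OF R'(2)] push_idm[OF T'(3)] by auto
  qed
  note T' = etriangleD[OF T] and R' = etriangleD[OF R]
  obtain c where c: "c \<in> Hom C D D'" "c \<odot> y = y'" "pull C c \<delta>' = \<delta>"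
    using *[OF T R] by blast
  obtain c' where c': "c' \<in> Hom C D' D" "c' \<odot> y' = y" "pull C c' \<delta> = \<delta>'"
    using *[OF R T] by blast
  have "c' \<odot> c \<in> Aut C D"
    by (rule etriangle_endo_last_Aut[OF T cmp_in_Hom[OF c(1) c'(1)]])
      (use cmp_assoc[OF T'(2) c(1) c'(1)] pull_cmp[OF T'(3) c'(1) c(1)] c c' in simp_all)
  moreover have "c \<odot> c' \<in> Aut C D'"
    by (rule etriangle_endo_last_Aut[OF R cmp_in_Hom[OF c'(1) c(1)]])
      (use cmp_assoc[OF R'(2) c'(1) c(1)] pull_cmp[OF R'(3) c(1) c'(1)] c c' in simp_all)
  ultimately show ?thesis
    using iso_morI_Aut[OF c(1) c'(1)] c(2) by blast
qed

text \<open>The inverse of \<open>a\<close> fixes \<open>x\<close> as well, so (ET3) supplies a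
  partner \<open>c'\<close> of it. Both composites of \<open>c\<close> and \<open>c'\<close> fix
  \<open>y\<close> and \<delta>.\<close>

lemma etriangle_Aut_last:
  assumes T: "etriangle C A B D x y \<delta>" and a: "a \<in> Aut C A" "x \<odot> a = x"
    and c: "c \<in> Hom C D D" "c \<odot> y = y" and eq: "push C a \<delta> = pull C c \<delta>"
  shows "c \<in> Aut C D"
proof -
  note T' = etriangleD[OF T]
  obtain a' where a': "a \<in> Hom C A A" "a' \<in> Hom C A A" "a' \<odot> a = idm C A" "a \<odot> a' = idm C A"
    using a(1) iso_mor_inverse unfolding Aut_def by blast
  have "x \<odot> a' = x"
    using cmp_assoc[OF a'(2,1) T'(1)] a(2) a'(4) cmp_idm_right[OF T'(1)] by simp
  then obtain c' where c': "c' \<in> Hom C D D" "c' \<odot> y = y" "push C a' \<delta> = pull C c' \<delta>"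
    using ET3[OF T T a'(2) idm_in_Hom] cmp_idm_left[OF T'(1)] cmp_idm_right[OF T'(2)] by auto
  have "pull C (c' \<odot> c) \<delta> = push C a' (push C a \<delta>)"
    using pull_cmp[OF T'(3) c'(1) c(1)] c'(3) push_pull[OF T'(3) a'(2) c(1)] eq by simp
  then have "pull C (c' \<odot> c) \<delta> = \<delta>"
    using push_cmp[OF T'(3) a'(1,2)] a'(3) push_idm[OF T'(3)] by simp
  then have "c' \<odot> c \<in> Aut C D"
    by (intro etriangle_endo_last_Aut[OF T cmp_in_Hom[OF c(1) c'(1)]])
      (use cmp_assoc[OF T'(2) c(1) c'(1)] c c' in simp_all)
  moreover have "pull C (c \<odot> c') \<delta> = push C a (push C a' \<delta>)"
    using pull_cmp[OF T'(3) c(1) c'(1)] c'(3) push_pull[OF T'(3) a'(1) c'(1)] eq by simp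
  then have "pull C (c \<odot> c') \<delta> = \<delta>"
    using push_cmp[OF T'(3) a'(2,1)] a'(4) push_idm[OF T'(3)] by simp
  then have "c \<odot> c' \<in> Aut C D"
    by (intro etriangle_endo_last_Aut[OF T cmp_in_Hom[OF c'(1) c(1)]])
      (use cmp_assoc[OF T'(2) c'(1) c(1)] c c' in simp_all)
  ultimately show ?thesis
    using iso_morI_Aut[OF c(1) c'(1)] by (simp add: Aut_def)
qed

lemma etriangle_Aut_iff:
  assumes T: "etriangle C A B D x y \<delta>" and a: "a \<in> Hom C A A" "x \<odot> a = x"
    and c: "c \<in> Hom C D D" "c \<odot> y = y" and eq: "push C a \<delta> = pull C c \<delta>"
  shows "a \<in> Aut C A \<longleftrightarrow> c \<in> Aut C D"
  using etriangle_Aut_last[OF T _ a(2) c eq]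
    extriangulated_category.etriangle_Aut_last[OF extriangulated_category_op,
      of D B A y x \<delta> c a] assms
  by auto

end

section \<open>Counting triangles\<close>

definition triangle_maps :: "('k, 'o, 'm, 'e) ext_cat \<Rightarrow> 'o \<Rightarrow> 'o \<Rightarrow> 'o \<Rightarrow> ('m \<times> 'm) set" where
  "triangle_maps C X L Y = {(f, g). \<exists>\<delta>. etriangle C X L Y f g \<delta>}"

lemma triangle_maps_op: "triangle_maps (op_cat C) Y L X = (triangle_maps C X L Y)\<inverse>"
  by (auto simp: triangle_maps_def)

context extriangulated_category
begin

text \<open>A cone isomorphic to \<open>Y\<close> can be replaced by \<open>Y\<close> itself through
  \<open>etriangle_iso_last\<close>.\<close>

lemma inflations_eq: "inflations_with_cone C X L Y = Domain (triangle_maps C X L Y)"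
proof -
  have "isomorphic C Y Y" using idm_in_Aut by (auto simp: isomorphic_def Aut_def)
  then show ?thesis
    using etriangle_iso_last
    unfolding inflations_with_cone_def triangle_maps_def isomorphic_def Domain_iff set_eq_iff
      mem_Collect_eq case_prod_conv by meson
qed

lemma deflations_eq: "deflations_with_cocone C X L Y = Range (triangle_maps C X L Y)"
proof -
  have "deflations_with_cocone C X L Y = inflations_with_cone (op_cat C) Y L X"
    by (auto simp: deflations_with_cocone_def inflations_with_cone_def isomorphic_op)
  then show ?thesis
    using extriangulated_category.inflations_eq[OF extriangulated_category_op]
    by (simp add: triangle_maps_op)
qed

text \<open>For a fixed inflation the deflations onto \<open>Y\<close> form a single orbit of
  \<open>Aut C Y\<close>.\<close>

lemma triangle_maps_fibre:
  assumes "(f, g) \<in> triangle_maps C X L Y"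
  shows "triangle_maps C X L Y `` {f} = (\<lambda>d. d \<odot> g) ` Aut C Y"
proof -
  obtain \<delta> where T: "etriangle C X L Y f g \<delta>" using assms by (auto simp: triangle_maps_def)
  show ?thesis
  proof (intro equalityI subsetI)
    fix g' assume "g' \<in> triangle_maps C X L Y `` {f}"
    then obtain \<delta>' where "etriangle C X L Y f g' \<delta>'" by (auto simp: triangle_maps_def)
    from etriangle_infl_unique[OF T this] show "g' \<in> (\<lambda>d. d \<odot> g) ` Aut C Y"
      by (auto simp: Aut_def)
  next
    fix g' assume "g' \<in> (\<lambda>d. d \<odot> g) ` Aut C Y"
    with etriangle_iso_last[OF T] show "g' \<in> triangle_maps C X L Y `` {f}"
      by (auto simp: triangle_maps_def Aut_def)
  qed
qed

lemma finite_triangle_maps: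
  assumes "\<And>U V. finite (Hom C U V)"
  shows "finite (triangle_maps C X L Y)"
proof (rule finite_subset)
  show "triangle_maps C X L Y \<subseteq> Hom C X L \<times> Hom C L Y"
    using etriangleD by (auto simp: triangle_maps_def)
qed (use assms in simp)

text \<open>Right multiplication by the inverse of \<open>d0\<close> moves the coset of all
  \<open>d\<close> with \<open>d g = d0 g\<close> to the stabilizer of \<open>d0 g\<close>.\<close>

lemma card_stabilizer_fibre:
  assumes g: "g \<in> Hom C L Y" and d0: "d0 \<in> Aut C Y"
  shows "card {d \<in> Aut C Y. d \<odot> g = d0 \<odot> g} = card {d \<in> Aut C Y. d \<odot> (d0 \<odot> g) = d0 \<odot> g}"
proof -
  obtain d1 where d1: "d0 \<in> Hom C Y Y" "d1 \<in> Hom C Y Y" "d1 \<odot> d0 = idm C Y" "d0 \<odot> d1 = idm C Y"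
      "iso_mor C Y Y d1"
    using d0 iso_mor_inverse unfolding Aut_def by blast
  have h: "d \<in> Hom C Y Y" if "d \<in> Aut C Y" for d using that by (simp add: Aut_def iso_mor_def)
  have a: "d \<odot> d' \<in> Aut C Y" if "d \<in> Aut C Y" "d' \<in> Aut C Y" for d d'
    using iso_mor_cmp that by (auto simp: Aut_def)
  have d1a: "d1 \<in> Aut C Y" using d1 by (simp add: Aut_def)
  have "bij_betw (\<lambda>d. d \<odot> d1) {d \<in> Aut C Y. d \<odot> g = d0 \<odot> g}
      {d \<in> Aut C Y. d \<odot> (d0 \<odot> g) = d0 \<odot> g}"
  proof (rule bij_betwI[where g = "\<lambda>d. d \<odot> d0"])
    have "(d \<odot> d1) \<odot> (d0 \<odot> g) = d \<odot> g" if "d \<in> Aut C Y" for d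
      using cmp_assoc[OF cmp_in_Hom[OF g d1(1)] d1(2) h[OF that]] cmp_assoc[OF g d1(1,2)] d1(3)
        cmp_idm_left[OF g] by simp
    then show "(\<lambda>d. d \<odot> d1) \<in> {d \<in> Aut C Y. d \<odot> g = d0 \<odot> g} \<rightarrow>
        {d \<in> Aut C Y. d \<odot> (d0 \<odot> g) = d0 \<odot> g}"
      using a d1a by auto
    show "(\<lambda>d. d \<odot> d0) \<in> {d \<in> Aut C Y. d \<odot> (d0 \<odot> g) = d0 \<odot> g} \<rightarrow>
        {d \<in> Aut C Y. d \<odot> g = d0 \<odot> g}"
      using a d0 cmp_assoc[OF g d1(1) h] by auto
    show "(d \<odot> d1) \<odot> d0 = d" if "d \<in> {d \<in> Aut C Y. d \<odot> g = d0 \<odot> g}" for d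
      using cmp_assoc[OF d1(1,2) h] d1(3) cmp_idm_right[OF h] that by auto
    show "(d \<odot> d0) \<odot> d1 = d" if "d \<in> {d \<in> Aut C Y. d \<odot> (d0 \<odot> g) = d0 \<odot> g}" for d
      using cmp_assoc[OF d1(2,1) h] d1(4) cmp_idm_right[OF h] that by auto
  qed
  then show ?thesis by (rule bij_betw_same_card)
qed

lemma card_inflations_Aut:
  assumes fin: "\<And>U V. finite (Hom C U V)"
  shows "card (inflations_with_cone C X L Y) * card (Aut C Y) =
    (\<Sum>(f, g)\<in>triangle_maps C X L Y. card {d \<in> Aut C Y. d \<odot> g = g})"
proof -
  let ?W = "triangle_maps C X L Y"
  have finW: "finite ?W" by (rule finite_triangle_maps[OF fin])
  have finA: "finite (Aut C Y)"
    by (rule finite_subset[OF _ fin[of Y Y]]) (auto simp: Aut_def iso_mor_def)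
  have fibre: "(\<Sum>g\<in>?W `` {f}. card {d \<in> Aut C Y. d \<odot> g = g}) = card (Aut C Y)"
    if f: "f \<in> Domain ?W" for f
  proof -
    obtain g where g: "(f, g) \<in> ?W" using f by auto
    then have gh: "g \<in> Hom C L Y" using etriangleD by (auto simp: triangle_maps_def)
    \<comment> \<open>\<open>Aut C Y\<close> is partitioned by the value \<open>d g\<close>; each
      part has the order of the stabilizer of that value, so stabilizer orders over an orbit add up
      to the group order.\<close>
    have "card (Aut C Y) = (\<Sum>h\<in>(\<lambda>d. d \<odot> g) ` Aut C Y. card {d \<in> Aut C Y. d \<odot> g = h})"
      using sum.image_gen[OF finA, of "\<lambda>_. 1 :: nat" "\<lambda>d. d \<odot> g"] by simp
    also have "\<dots> = (\<Sum>h\<in>(\<lambda>d. d \<odot> g) ` Aut C Y. card {d \<in> Aut C Y. d \<odot> h = h})"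
      by (rule sum.cong) (use card_stabilizer_fibre[OF gh] in auto)
    finally show ?thesis unfolding triangle_maps_fibre[OF g] by simp
  qed
  have "?W = (SIGMA f:Domain ?W. ?W `` {f})" by auto
  then have "(\<Sum>(f, g)\<in>?W. card {d \<in> Aut C Y. d \<odot> g = g}) =
      (\<Sum>(f, g)\<in>(SIGMA f:Domain ?W. ?W `` {f}). card {d \<in> Aut C Y. d \<odot> g = g})"
    by (rule arg_cong)
  also have "\<dots> = (\<Sum>f\<in>Domain ?W. \<Sum>g\<in>?W `` {f}. card {d \<in> Aut C Y. d \<odot> g = g})"
    by (rule sum.Sigma[symmetric]) (use finW in \<open>auto intro: finite_Domain finite_Image\<close>)
  also have "\<dots> = card (Domain ?W) * card (Aut C Y)"
    using fibre by simp
  finally show ?thesis by (simp add: inflations_eq)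
qed

lemma card_deflations_Aut:
  assumes fin: "\<And>U V. finite (Hom C U V)"
  shows "card (deflations_with_cocone C X L Y) * card (Aut C X) =
    (\<Sum>(f, g)\<in>triangle_maps C X L Y. card {a \<in> Aut C X. f \<odot> a = f})"
proof -
  interpret op: extriangulated_category "op_cat C" by (rule extriangulated_category_op)
  have "card (inflations_with_cone (op_cat C) Y L X) * card (Aut C X) =
      (\<Sum>(g, f)\<in>(triangle_maps C X L Y)\<inverse>. card {a \<in> Aut C X. f \<odot> a = f})"
    using op.card_inflations_Aut[of Y L X] fin by (simp add: triangle_maps_op)
  also have "\<dots> = (\<Sum>(f, g)\<in>triangle_maps C X L Y. card {a \<in> Aut C X. f \<odot> a = f})"
    by (rule sum.reindex_bij_witness[of _ prod.swap prod.swap]) auto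
  finally show ?thesis
    by (simp add: op.inflations_eq deflations_eq triangle_maps_op)
qed

end

section \<open>Kernels attached to a triangle\<close>

context extriangulated_category
begin

lemma card_stabilizer_kernel:
  assumes g: "g \<in> Hom C L Y"
  shows "card {d \<in> Aut C Y. d \<odot> g = g} = card {u \<in> Hom C Y Y. u \<odot> g = 0 \<and> idm C Y + u \<in> Aut C Y}"
proof -
  have h: "d \<in> Hom C Y Y" if "d \<in> Aut C Y" for d using that by (simp add: Aut_def iso_mor_def)
  have "bij_betw (\<lambda>d. d - idm C Y) {d \<in> Aut C Y. d \<odot> g = g}
      {u \<in> Hom C Y Y. u \<odot> g = 0 \<and> idm C Y + u \<in> Aut C Y}"
  proof (rule bij_betwI[where g = "\<lambda>u. idm C Y + u"])
    show "(\<lambda>d. d - idm C Y) \<in> {d \<in> Aut C Y. d \<odot> g = g} \<rightarrow>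
        {u \<in> Hom C Y Y. u \<odot> g = 0 \<and> idm C Y + u \<in> Aut C Y}"
      using h cmp_diff_left[OF g h idm_in_Hom] cmp_idm_left[OF g] by auto
    show "(\<lambda>u. idm C Y + u) \<in> {u \<in> Hom C Y Y. u \<odot> g = 0 \<and> idm C Y + u \<in> Aut C Y} \<rightarrow>
        {d \<in> Aut C Y. d \<odot> g = g}"
      using cmp_add_left[OF g idm_in_Hom] cmp_idm_left[OF g] by auto
  qed auto
  then show ?thesis by (rule bij_betw_same_card)
qed

lemma card_stabilizer_kernel_op:
  assumes f: "f \<in> Hom C X L"
  shows "card {a \<in> Aut C X. f \<odot> a = f} = card {v \<in> Hom C X X. f \<odot> v = 0 \<and> idm C X + v \<in> Aut C X}"
  using extriangulated_category.card_stabilizer_kernel[OF extriangulated_category_op, of f L X] f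
  by simp

context
  fixes X L Y f g \<delta>
  assumes T: "etriangle C X L Y f g \<delta>" and fin: "\<And>U V. finite (Hom C U V)"
begin

lemma etriangle_extend_mid:
  assumes "b \<in> Hom C L U" "b \<odot> f = 0"
  shows "\<exists>a\<in>Hom C Y U. b = a \<odot> g"
  using extriangulated_category.etriangle_lift_infl[OF extriangulated_category_op, of Y L X g f \<delta> b U]
    T assms by simp

text \<open>Pairs \<open>(v, u)\<close> such that \<open>(v, 0, u)\<close> is an endomorphism of the triangle.\<close>

definition endo_pairs where
  "endo_pairs = {(v, u). v \<in> Hom C X X \<and> u \<in> Hom C Y Y \<and> f \<odot> v = 0 \<and> u \<odot> g = 0 \<and>
     push C v \<delta> = pull C u \<delta>}"

lemma endo_pairs_finite: "finite endo_pairs"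
  by (rule finite_subset[of _ "Hom C X X \<times> Hom C Y Y"]) (auto simp: endo_pairs_def fin)

lemma endo_pairs_diff:
  "(v, u) \<in> endo_pairs \<Longrightarrow> (v', u') \<in> endo_pairs \<Longrightarrow> (v - v', u - u') \<in> endo_pairs"
  using etriangleD[OF T]
  by (auto simp: endo_pairs_def cmp_diff_left[of g L Y] cmp_diff_right[of _ X X _ f L]
      push_diff_mor pull_diff_mor)

text \<open>\<open>f v = 0\<close> says that \<open>v\<close> and the zero map in the middle form a
  commuting square, to which (ET3) applies.\<close>

lemma endo_pairs_Domain: "{v \<in> Hom C X X. f \<odot> v = 0} \<subseteq> Domain endo_pairs"
proof
  note T' = etriangleD[OF T]
  fix v assume "v \<in> {v \<in> Hom C X X. f \<odot> v = 0}"
  then have v: "v \<in> Hom C X X" "f \<odot> v = 0" by auto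
  have "0 \<odot> f = f \<odot> v" using v cmp_0_left[OF T'(1)] by simp
  from ET3[OF T T v(1) Hom_0 this] obtain u
    where "u \<in> Hom C Y Y" "u \<odot> g = g \<odot> 0" "push C v \<delta> = pull C u \<delta>" by blast
  then have "(v, u) \<in> endo_pairs"
    using v cmp_0_right[OF T'(2)] by (simp add: endo_pairs_def)
  then show "v \<in> Domain endo_pairs" by blast
qed

lemma endo_pairs_Range: "{u \<in> Hom C Y Y. u \<odot> g = 0} \<subseteq> Range endo_pairs"
proof
  note T' = etriangleD[OF T]
  fix u assume "u \<in> {u \<in> Hom C Y Y. u \<odot> g = 0}"
  then have u: "u \<in> Hom C Y Y" "u \<odot> g = 0" by auto
  have "u \<odot> g = g \<odot> 0" using u cmp_0_right[OF T'(2)] by simp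
  from ET3_op[OF T T Hom_0 u(1) this] obtain v
    where "v \<in> Hom C X X" "0 \<odot> f = f \<odot> v" "push C v \<delta> = pull C u \<delta>" by blast
  then have "(v, u) \<in> endo_pairs"
    using u cmp_0_left[OF T'(1)] by (simp add: endo_pairs_def)
  then show "u \<in> Range endo_pairs" by blast
qed

text \<open>Adding the identity endomorphism to \<open>(v, 0, u)\<close> gives one with the identity
  in the middle, the situation of \<open>etriangle_Aut_iff\<close>.\<close>

lemma endo_pairs_Aut:
  assumes "(v, u) \<in> endo_pairs"
  shows "idm C X + v \<in> Aut C X \<longleftrightarrow> idm C Y + u \<in> Aut C Y"
proof (rule etriangle_Aut_iff[OF T])
  note T' = etriangleD[OF T]
  have vu: "v \<in> Hom C X X" "u \<in> Hom C Y Y" "f \<odot> v = 0" "u \<odot> g = 0" "push C v \<delta> = pull C u \<delta>"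
    using assms by (auto simp: endo_pairs_def)
  show "idm C X + v \<in> Hom C X X" "idm C Y + u \<in> Hom C Y Y" using vu by auto
  show "f \<odot> (idm C X + v) = f"
    using cmp_add_right[OF idm_in_Hom vu(1) T'(1)] vu cmp_idm_right[OF T'(1)] by simp
  show "(idm C Y + u) \<odot> g = g"
    using cmp_add_left[OF T'(2) idm_in_Hom vu(2)] vu cmp_idm_left[OF T'(2)] by simp
  show "push C (idm C X + v) \<delta> = pull C (idm C Y + u) \<delta>"
    using push_add_mor[OF T'(3) idm_in_Hom vu(1)] pull_add_mor[OF T'(3) idm_in_Hom vu(2)] vu
      push_idm[OF T'(3)] pull_idm[OF T'(3)] by simp
qed

lemma endo_pairs_card:
  "card {v \<in> Hom C X X. f \<odot> v = 0} * card {u. (0, u) \<in> endo_pairs} =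
   card {u \<in> Hom C Y Y. u \<odot> g = 0} * card {v. (v, 0) \<in> endo_pairs}"
  by (rule card_relation[OF endo_pairs_finite endo_pairs_diff endo_pairs_Domain endo_pairs_Range])
    (auto simp: endo_pairs_def)

text \<open>Counting units and counting whole kernels with \<open>endo_pairs\<close> involves the
  same two fibres over 0, which therefore cancel.\<close>

lemma stabilizer_ratio:
  "card {a \<in> Aut C X. f \<odot> a = f} * card {u \<in> Hom C Y Y. u \<odot> g = 0} =
   card {d \<in> Aut C Y. d \<odot> g = g} * card {v \<in> Hom C X X. f \<odot> v = 0}"
proof -
  note T' = etriangleD[OF T]
  let ?S = "{v \<in> Hom C X X. f \<odot> v = 0 \<and> idm C X + v \<in> Aut C X}"
  let ?S' = "{u \<in> Hom C Y Y. u \<odot> g = 0 \<and> idm C Y + u \<in> Aut C Y}"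
  let ?n = "card {v. (v, 0) \<in> endo_pairs}" and ?n' = "card {u. (0, u) \<in> endo_pairs}"
  have S: "card ?S * ?n' = card ?S' * ?n"
    by (rule card_relation[OF endo_pairs_finite endo_pairs_diff])
      (use endo_pairs_Domain endo_pairs_Range endo_pairs_Aut in \<open>auto simp: endo_pairs_def\<close>)
  have "(0, 0) \<in> endo_pairs"
    using cmp_0_left[OF T'(2)] cmp_0_right[OF T'(1)] push_zero_mor[OF T'(3)] pull_zero_mor[OF T'(3)]
    by (simp add: endo_pairs_def)
  moreover have "finite {v. (v, 0) \<in> endo_pairs}"
    by (rule finite_subset[OF _ finite_Domain[OF endo_pairs_finite]]) auto
  ultimately have n: "0 < ?n" by (auto simp: card_gt_0_iff)
  have "card ?S * (card {u \<in> Hom C Y Y. u \<odot> g = 0} * ?n) =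
      card {v \<in> Hom C X X. f \<odot> v = 0} * (card ?S * ?n')"
    unfolding endo_pairs_card[symmetric] by (rule mult.left_commute)
  then have "card ?S * card {u \<in> Hom C Y Y. u \<odot> g = 0} * ?n =
      card ?S' * card {v \<in> Hom C X X. f \<odot> v = 0} * ?n"
    unfolding S by (simp only: mult_ac)
  with n show ?thesis
    unfolding card_stabilizer_kernel[OF T'(2)] card_stabilizer_kernel_op[OF T'(1)] by simp
qed

text \<open>The two kernels of the projections of \<open>endo_pairs\<close> are \<open>A f\<close> and \<open>g A'\<close>, where
  \<open>A = {w : L \<rightarrow> X | f w f = 0}\<close> and \<open>A' = {w : Y \<rightarrow> L | g w g = 0}\<close>; in turn \<open>A\<close> and \<open>A'\<close>
  are matched by the relation \<open>f w = w' g\<close>.\<close>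

lemma kernel_cards:
  "card {\<phi> \<in> Hom C X X. f \<odot> \<phi> = 0} * card {\<phi> \<in> Hom C Y X. f \<odot> \<phi> = 0} *
     card {\<psi> \<in> Hom C Y L. \<psi> \<odot> g = 0} =
   card {\<psi> \<in> Hom C Y X. \<psi> \<odot> g = 0} * card {\<psi> \<in> Hom C Y Y. \<psi> \<odot> g = 0} *
     card {\<phi> \<in> Hom C L X. f \<odot> \<phi> = 0}"
proof -
  note T' = etriangleD[OF T]
  define A where "A = {w \<in> Hom C L X. f \<odot> w \<odot> f = 0}"
  define A' where "A' = {w \<in> Hom C Y L. g \<odot> w \<odot> g = 0}"
  define R where "R = {(w, w'). w \<in> A \<and> w' \<in> A' \<and> f \<odot> w = w' \<odot> g}"
  have gf: "g \<odot> f = 0" by (rule etriangle_cmp_zero[OF T])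
  have finA: "finite A" "finite A'" using fin by (simp_all add: A_def A'_def)
  have A0: "0 \<in> A" "0 \<in> A'"
    using cmp_0_left[OF T'(1)] cmp_0_right[OF T'(1)] cmp_0_left[OF T'(2)] cmp_0_right[OF T'(2)]
    by (simp_all add: A_def A'_def)
  have Ad: "a - b \<in> A" if "a \<in> A" "b \<in> A" for a b
  proof -
    have "a \<in> Hom C L X" "b \<in> Hom C L X" using that by (auto simp: A_def)
    then show ?thesis
      using that cmp_diff_left[OF T'(1), of a X b] T'(1)
        cmp_diff_right[OF cmp_in_Hom[OF T'(1)] cmp_in_Hom[OF T'(1)] T'(1), of a b]
      by (auto simp: A_def)
  qed
  have Ad': "a - b \<in> A'" if "a \<in> A'" "b \<in> A'" for a b
  proof -
    have "a \<in> Hom C Y L" "b \<in> Hom C Y L" using that by (auto simp: A'_def)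
    then show ?thesis
      using that cmp_diff_left[OF T'(2), of a L b] T'(2)
        cmp_diff_right[OF cmp_in_Hom[OF T'(2)] cmp_in_Hom[OF T'(2)] T'(2), of a b]
      by (auto simp: A'_def)
  qed
  have Rd: "(a - b, a' - b') \<in> R" if "(a, a') \<in> R" "(b, b') \<in> R" for a b a' b'
  proof -
    have h: "a \<in> Hom C L X" "b \<in> Hom C L X" "a' \<in> Hom C Y L" "b' \<in> Hom C Y L"
      using that by (auto simp: A_def A'_def R_def)
    show ?thesis
      using that Ad Ad' cmp_diff_left[OF T'(2) h(3,4)] cmp_diff_right[OF h(1,2) T'(1)]
      by (auto simp: R_def)
  qed
  \<comment> \<open>The relation is total on both sides: \<open>f w\<close> vanishes on
    \<open>f\<close>, so it factors through \<open>g\<close>; dually \<open>w' g\<close> is killed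
    by \<open>g\<close> and factors through \<open>f\<close>.\<close>
  have RD: "A \<subseteq> Domain R"
  proof
    fix w assume w: "w \<in> A"
    then have wh: "w \<in> Hom C L X" "f \<odot> w \<odot> f = 0" by (auto simp: A_def)
    have "(f \<odot> w) \<odot> f = 0" using cmp_assoc[OF T'(1) wh(1) T'(1)] wh(2) by simp
    then obtain w' where w': "w' \<in> Hom C Y L" "f \<odot> w = w' \<odot> g"
      using etriangle_extend_mid[OF cmp_in_Hom[OF wh(1) T'(1)]] by blast
    have "g \<odot> w' \<odot> g = (g \<odot> f) \<odot> w"
      using w'(2) cmp_assoc[OF wh(1) T'(1,2)] by simp
    then have "w' \<in> A'" using gf cmp_0_left[OF wh(1)] w'(1) by (simp add: A'_def)
    with w w' show "w \<in> Domain R" by (auto simp: R_def)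
  qed
  have RR: "A' \<subseteq> Range R"
  proof
    fix w' assume w': "w' \<in> A'"
    then have wh: "w' \<in> Hom C Y L" "g \<odot> w' \<odot> g = 0" by (auto simp: A'_def)
    then obtain w where w: "w \<in> Hom C L X" "w' \<odot> g = f \<odot> w"
      using etriangle_lift_infl[OF T cmp_in_Hom[OF T'(2) wh(1)]] by blast
    have "f \<odot> w \<odot> f = w' \<odot> (g \<odot> f)"
      using cmp_assoc[OF T'(1) w(1) T'(1)] cmp_assoc[OF T'(1,2) wh(1)] w(2) by simp
    then have "w \<in> A" using gf cmp_0_right[OF wh(1)] w(1) by (simp add: A_def)
    with w w' show "w' \<in> Range R" by (auto simp: R_def intro: sym)
  qed
  have AA': "card A * card {\<psi> \<in> Hom C Y L. \<psi> \<odot> g = 0} =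
      card A' * card {\<phi> \<in> Hom C L X. f \<odot> \<phi> = 0}"
  proof -
    have "card A * card {w'. (0, w') \<in> R} = card A' * card {w. (w, 0) \<in> R}"
      by (rule card_relation[OF _ Rd RD RR])
        (use finA in \<open>auto simp: R_def intro: finite_subset[of _ "A \<times> A'"]\<close>)
    moreover have "{w'. (0, w') \<in> R} = {\<psi> \<in> Hom C Y L. \<psi> \<odot> g = 0}"
      using A0 cmp_0_right[OF T'(1)] cmp_0_right[OF T'(2)] by (auto simp: R_def A'_def)
    moreover have "{w. (w, 0) \<in> R} = {\<phi> \<in> Hom C L X. f \<odot> \<phi> = 0}"
    proof -
      have "f \<odot> w \<odot> f = 0" if "w \<in> Hom C L X" "f \<odot> w = 0" for w
        using cmp_assoc[OF T'(1) that(1) T'(1)] that(2) cmp_0_left[OF T'(1)] by simp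
      then show ?thesis
        using A0 cmp_0_left[OF T'(2)] by (auto simp: R_def A_def)
    qed
    ultimately show ?thesis by simp
  qed
  \<comment> \<open>The two images of \<open>Hom C Y X\<close> recur below as the kernel of
    \<open>w f\<close> on \<open>A\<close> and the kernel of \<open>g w\<close> on
    \<open>A'\<close>.\<close>
  have H: "card (Hom C Y X) = card ((\<lambda>\<psi>. \<psi> \<odot> g) ` Hom C Y X) * card {\<psi> \<in> Hom C Y X. \<psi> \<odot> g = 0}"
    by (rule card_image_kernel) (use fin cmp_diff_left[OF T'(2)] in auto)
  have H': "card (Hom C Y X) = card ((\<lambda>\<phi>. f \<odot> \<phi>) ` Hom C Y X) * card {\<phi> \<in> Hom C Y X. f \<odot> \<phi> = 0}"
    by (rule card_image_kernel) (use fin cmp_diff_right[OF _ _ T'(1)] in auto)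
  have A: "card A = card ((\<lambda>w. w \<odot> f) ` A) * card ((\<lambda>\<psi>. \<psi> \<odot> g) ` Hom C Y X)"
  proof -
    have "{w \<in> A. w \<odot> f = 0} = (\<lambda>\<psi>. \<psi> \<odot> g) ` Hom C Y X"
    proof (intro equalityI subsetI)
      fix w assume "w \<in> {w \<in> A. w \<odot> f = 0}"
      then show "w \<in> (\<lambda>\<psi>. \<psi> \<odot> g) ` Hom C Y X"
        using etriangle_extend_mid[of w X] by (auto simp: A_def)
    next
      fix w assume "w \<in> (\<lambda>\<psi>. \<psi> \<odot> g) ` Hom C Y X"
      then obtain \<psi> where \<psi>: "\<psi> \<in> Hom C Y X" "w = \<psi> \<odot> g" by auto
      have "w \<odot> f = 0" using cmp_assoc[OF T'(1,2) \<psi>(1)] \<psi>(2) gf cmp_0_right[OF \<psi>(1)] by simp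
      then show "w \<in> {w \<in> A. w \<odot> f = 0}"
        using \<psi> T' cmp_0_right[OF T'(1)] by (auto simp: A_def)
    qed
    moreover have "card A = card ((\<lambda>w. w \<odot> f) ` A) * card {w \<in> A. w \<odot> f = 0}"
      by (rule card_image_kernel)
        (use finA A0 Ad cmp_diff_left[OF T'(1)] in \<open>auto simp: A_def\<close>)
    ultimately show ?thesis by simp
  qed
  have A': "card A' = card ((\<lambda>w. g \<odot> w) ` A') * card ((\<lambda>\<phi>. f \<odot> \<phi>) ` Hom C Y X)"
  proof -
    have "{w \<in> A'. g \<odot> w = 0} = (\<lambda>\<phi>. f \<odot> \<phi>) ` Hom C Y X"
    proof (intro equalityI subsetI)
      fix w assume "w \<in> {w \<in> A'. g \<odot> w = 0}"
      then show "w \<in> (\<lambda>\<phi>. f \<odot> \<phi>) ` Hom C Y X"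
        using etriangle_lift_infl[OF T, of w Y] by (auto simp: A'_def)
    next
      fix w assume "w \<in> (\<lambda>\<phi>. f \<odot> \<phi>) ` Hom C Y X"
      then obtain \<phi> where \<phi>: "\<phi> \<in> Hom C Y X" "w = f \<odot> \<phi>" by auto
      have wh: "w \<in> Hom C Y L" using \<phi> T' by auto
      have gw: "g \<odot> w = 0" using cmp_assoc[OF \<phi>(1) T'(1,2)] \<phi>(2) gf cmp_0_left[OF \<phi>(1)] by simp
      then have "g \<odot> w \<odot> g = 0" using cmp_assoc[OF T'(2) wh T'(2)] cmp_0_left[OF T'(2)] by simp
      then show "w \<in> {w \<in> A'. g \<odot> w = 0}"
        using wh gw by (auto simp: A'_def)
    qed
    moreover have "card A' = card ((\<lambda>w. g \<odot> w) ` A') * card {w \<in> A'. g \<odot> w = 0}"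
      by (rule card_image_kernel)
        (use finA A0 Ad' cmp_diff_right[OF _ _ T'(2)] in \<open>auto simp: A'_def\<close>)
    ultimately show ?thesis by simp
  qed
  have Af: "{v. (v, 0) \<in> endo_pairs} = (\<lambda>w. w \<odot> f) ` A"
  proof (intro equalityI subsetI)
    fix v assume "v \<in> {v. (v, 0) \<in> endo_pairs}"
    then have v: "v \<in> Hom C X X" "f \<odot> v = 0" "push C v \<delta> = 0"
      using pull_zero_mor[OF T'(3)] by (auto simp: endo_pairs_def)
    then show "v \<in> (\<lambda>w. w \<odot> f) ` A"
      using etriangle_extend_infl[OF T v(1)] by (auto simp: A_def)
  next
    fix v assume "v \<in> (\<lambda>w. w \<odot> f) ` A"
    then obtain w where w: "w \<in> Hom C L X" "f \<odot> w \<odot> f = 0" "v = w \<odot> f" by (auto simp: A_def)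
    have "push C f \<delta> = 0"
      using extriangulated_category.etriangle_pull_zero[OF extriangulated_category_op, of Y L X g f \<delta>]
        T by simp
    then have "push C v \<delta> = 0" using push_cmp[OF T'(3,1) w(1)] w(3) push_0[OF w(1)] by simp
    then show "v \<in> {v. (v, 0) \<in> endo_pairs}"
      using w T' cmp_0_left[OF T'(2)] pull_zero_mor[OF T'(3)] by (auto simp: endo_pairs_def)
  qed
  have gA': "{u. (0, u) \<in> endo_pairs} = (\<lambda>w. g \<odot> w) ` A'"
  proof (intro equalityI subsetI)
    fix u assume "u \<in> {u. (0, u) \<in> endo_pairs}"
    then have u: "u \<in> Hom C Y Y" "u \<odot> g = 0" "pull C u \<delta> = 0"
      using push_zero_mor[OF T'(3)] by (auto simp: endo_pairs_def)
    then obtain w where w: "w \<in> Hom C Y L" "u = g \<odot> w"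
      using etriangle_lift_defl[OF T u(1)] by blast
    then show "u \<in> (\<lambda>w. g \<odot> w) ` A'"
      using u(2) cmp_assoc[OF T'(2) w(1) T'(2)] by (auto simp: A'_def)
  next
    fix u assume "u \<in> (\<lambda>w. g \<odot> w) ` A'"
    then obtain w where w: "w \<in> Hom C Y L" "g \<odot> w \<odot> g = 0" "u = g \<odot> w" by (auto simp: A'_def)
    have "pull C u \<delta> = 0"
      using pull_cmp[OF T'(3,2) w(1)] w(3) etriangle_pull_zero[OF T] pull_0[OF w(1)] by simp
    then show "u \<in> {u. (0, u) \<in> endo_pairs}"
      using w T' cmp_assoc[OF T'(2) w(1) T'(2)] cmp_0_right[OF T'(1)] push_zero_mor[OF T'(3)]
      by (auto simp: endo_pairs_def)
  qed
  let ?KX = "card {\<phi> \<in> Hom C X X. f \<odot> \<phi> = 0}" and ?KY = "card {\<phi> \<in> Hom C Y X. f \<odot> \<phi> = 0}"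
  let ?KL = "card {\<phi> \<in> Hom C L X. f \<odot> \<phi> = 0}" and ?KL' = "card {\<psi> \<in> Hom C Y L. \<psi> \<odot> g = 0}"
  let ?KX' = "card {\<psi> \<in> Hom C Y X. \<psi> \<odot> g = 0}" and ?KY' = "card {\<psi> \<in> Hom C Y Y. \<psi> \<odot> g = 0}"
  let ?Af = "card ((\<lambda>w. w \<odot> f) ` A)" and ?gA' = "card ((\<lambda>w. g \<odot> w) ` A')"
  \<comment> \<open>The factor \<open>?KY\<close> completes an image of \<open>Hom C Y X\<close> to
    the whole space, and \<open>?KX'\<close> does so on the other side;
    \<open>endo_pairs_card\<close> exchanges \<open>?gA'\<close> for \<open>?Af\<close> in between.
    Finally \<open>AA'\<close> lets \<open>card A'\<close>, which is positive, be cancelled.\<close>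
  have "?KX * ?KY * card A' = ?KX * ?gA' * card (Hom C Y X)"
    unfolding A' H' by (simp add: mult_ac)
  also have "\<dots> = ?KY' * ?Af * card (Hom C Y X)"
    using endo_pairs_card unfolding Af gA' by simp
  also have "\<dots> = ?KY' * ?KX' * card A"
    unfolding A H by (simp add: mult_ac)
  finally have "?KX * ?KY * ?KL' * card A' = ?KX' * ?KY' * (card A * ?KL')"
    by (simp add: mult_ac)
  also have "\<dots> = ?KX' * ?KY' * ?KL * card A'"
    unfolding AA' by (simp add: mult_ac)
  finally show ?thesis
    using finA A0 by (auto simp: card_gt_0_iff)
qed

end

end

section \<open>The counting formula\<close>

lemma fin_total_dim_op [simp]: "fin_total_dim (op_cat C) V \<longleftrightarrow> fin_total_dim C V"
  by (simp add: fin_total_dim_def fin_dim_def)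

text \<open>Each variable is a bracket of the two named objects, of type I without and of type II
  with a prime. The hypothesis is \<open>kernel_cards\<close> in terms of brackets; multiplying it
  by the monomial \<open>?t\<close> gives the claim.\<close>

lemma bracket_identity:
  fixes XX XY XL YX YY YL LX LY LL XX' XY' XL' YX' YY' YL' LX' LY' LL' :: real
  assumes pos: "XX > 0" "XY > 0" "YX > 0" "YY > 0" "LX > 0" "LY > 0" "LL > 0"
      "XX' > 0" "XY' > 0" "XL' > 0" "YX' > 0" "YY' > 0" "YL' > 0" "LX' > 0"
    and eq: "XL / (XX * XY) * (YL / (YX * YY)) * (LL' / (YL' * XL')) =
      LX' / (YX' * XX') * (LY' / (YY' * XY')) * (LL / (LX * LY))"
  shows "LY / YY * (YX' / YX * (YL / YL') * (LX / LX') * (LL' / LL)) * (XL / (XX * XY)) =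
    XL' / XX' * (LY' / (YY' * XY'))"
proof -
  let ?t = "YX' * LX * LY * XL' / (LX' * LL)"
  have "LY / YY * (YX' / YX * (YL / YL') * (LX / LX') * (LL' / LL)) * (XL / (XX * XY)) =
      XL / (XX * XY) * (YL / (YX * YY)) * (LL' / (YL' * XL')) * ?t"
    using pos by (simp add: field_simps)
  also have "\<dots> = XL' / XX' * (LY' / (YY' * XY'))"
    unfolding eq using pos by (simp add: field_simps)
  finally show ?thesis .
qed

theorem theorem5p5:
  fixes C :: "('k::{field,finite}, 'o, 'm::ab_group_add, 'e::ab_group_add) ext_cat"
    and P J :: "'o \<Rightarrow> ('o, 'm, 'e) etri"
    and X Y L :: 'o
  assumes "extriangulated_category C"
    and "Krull_Schmidt C"
    and "enough_projective_mors C" and "enough_injective_mors C"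
    and "projective_presentations C P" and "injective_presentations C J"
    and "\<And>U V. fin_total_dim C (\<lambda>n. negI C P n U V)"
    and "\<And>U V. fin_total_dim C (\<lambda>n. negII C J n U V)"
  shows "real (card (deflations_with_cocone C X L Y)) / real (card (Aut C Y)) *
           (brI C P L Y / brI C P Y Y) * hbar_factor C P J X Y L =
         real (card (inflations_with_cone C X L Y)) / real (card (Aut C X)) *
           (brII C J X L / brII C J X X)"
proof -
  interpret extriangulated_category C by (rule assms(1))
  interpret I: finite_projectively_presented C P
    by unfold_locales (use assms in auto)
  \<comment> \<open>The type I results for the opposite category with reversed injective
    presentations are statements about \<open>brII\<close>, with its arguments exchanged.\<close>
  interpret II: finite_projectively_presented "op_cat C" "\<lambda>Z. op_etri (J Z)"
    by (intro finite_projectively_presented.intro projectively_presented.intro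
        extriangulated_category_op projectively_presented_axioms.intro
        finite_projectively_presented_axioms.intro)
      (use assms in \<open>auto simp: projective_presentations_op negI_op\<close>)
  let ?W = "triangle_maps C X L Y"
  have posII: "0 < brII C J U V" for U V
    using II.brI_pos[of V U] by (simp add: brI_op)
  have kerI: "real (card {\<phi> \<in> Hom C U X. f \<odot>\<^bsub>C\<^esub> \<phi> = 0}) = brI C P U L / (brI C P U X * brI C P U Y)"
    if "etriangle C X L Y f g \<delta>" for f g \<delta> U
    using I.brI_triangle[OF that, of U] I.brI_pos[of U X] I.brI_pos[of U Y] by simp
  have kerII: "real (card {\<psi> \<in> Hom C Y U. \<psi> \<odot>\<^bsub>C\<^esub> g = 0}) =
      brII C J L U / (brII C J Y U * brII C J X U)"
    if "etriangle C X L Y f g \<delta>" for f g \<delta> U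
    using II.brI_triangle[of Y L X g f \<delta> U] that posII[of Y U] posII[of X U] by (simp add: brI_op)
  show ?thesis
  \<comment> \<open>Without triangles both counts vanish; otherwise any one triangle serves to
    relate the constants.\<close>
  proof (cases "?W = {}")
    case True
    then show ?thesis by (simp add: inflations_eq deflations_eq)
  next
    case False
    \<comment> \<open>By \<open>kerI\<close> and \<open>kerII\<close>, \<kappa> and
      \<open>\<kappa>'\<close> are the orders of {v : X -> X | f v = 0} and {u : Y -> Y | u g = 0}.
      These are the same for all triangles and can be moved out of the sums over
      \<open>?W\<close>.\<close>
    define \<kappa> where "\<kappa> = brI C P X L / (brI C P X X * brI C P X Y)"
    define \<kappa>' where "\<kappa>' = brII C J L Y / (brII C J Y Y * brII C J X Y)"
    define c where "c = brI C P L Y / brI C P Y Y * hbar_factor C P J X Y L"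
    define c' where "c' = brII C J X L / brII C J X X"
    have \<kappa>pos: "0 < \<kappa>" and \<kappa>'pos: "0 < \<kappa>'"
      using I.brI_pos posII by (simp_all add: \<kappa>_def \<kappa>'_def)
    obtain f g \<delta> where T: "etriangle C X L Y f g \<delta>"
      using False unfolding triangle_maps_def by blast
    from arg_cong[OF kernel_cards[OF T I.finite_Hom], of real]
    have "c * \<kappa> = c' * \<kappa>'"
      unfolding of_nat_mult kerI[OF T] kerII[OF T] c_def c'_def \<kappa>_def \<kappa>'_def hbar_factor_def
      by (intro bracket_identity) (use I.brI_pos posII in auto)
    moreover have "real (card (deflations_with_cocone C X L Y) * card (Aut C X)) * \<kappa>' =
        real (card (inflations_with_cone C X L Y) * card (Aut C Y)) * \<kappa>"
    proof -
      have "real (card {a \<in> Aut C X. f \<odot>\<^bsub>C\<^esub> a = f}) * \<kappa>' = real (card {d \<in> Aut C Y. d \<odot>\<^bsub>C\<^esub> g = g}) * \<kappa>"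
        if fg: "(f, g) \<in> ?W" for f g
      proof -
        obtain \<delta> where T: "etriangle C X L Y f g \<delta>" using fg by (auto simp: triangle_maps_def)
        from arg_cong[OF stabilizer_ratio[OF T I.finite_Hom], of real] show ?thesis
          unfolding of_nat_mult kerI[OF T] kerII[OF T] \<kappa>_def \<kappa>'_def .
      qed
      then show ?thesis
        unfolding card_inflations_Aut[OF I.finite_Hom] card_deflations_Aut[OF I.finite_Hom]
          of_nat_sum sum_distrib_right
        by (intro sum.cong) auto
    qed
    moreover have "0 < card (Aut C U)" for U
    proof -
      have "finite (Aut C U)"
        by (rule finite_subset[OF _ I.finite_Hom[of U U]]) (auto simp: Aut_def iso_mor_def)
      with idm_in_Aut show ?thesis by (auto simp: card_gt_0_iff)
    qed
    ultimately have "real (card (deflations_with_cocone C X L Y)) / real (card (Aut C Y)) * c =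
        real (card (inflations_with_cone C X L Y)) / real (card (Aut C X)) * c'"
    proof -
      assume c: "c * \<kappa> = c' * \<kappa>'"
        and sums: "real (card (deflations_with_cocone C X L Y) * card (Aut C X)) * \<kappa>' =
          real (card (inflations_with_cone C X L Y) * card (Aut C Y)) * \<kappa>"
        and Aut: "\<And>U. 0 < card (Aut C U)"
      let ?d = "real (card (deflations_with_cocone C X L Y))"
        and ?i = "real (card (inflations_with_cone C X L Y))"
        and ?x = "real (card (Aut C X))" and ?y = "real (card (Aut C Y))"
      have "(?d * ?x * c) * (\<kappa> * \<kappa>') = (?d * ?x * \<kappa>') * (c * \<kappa>)" by (simp add: mult_ac)
      also have "\<dots> = (?i * ?y * \<kappa>) * (c' * \<kappa>')" using sums c by simp
      also have "\<dots> = (?i * ?y * c') * (\<kappa> * \<kappa>')" by (simp add: mult_ac)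
      finally have "?d * ?x * c = ?i * ?y * c'" using \<kappa>pos \<kappa>'pos by simp
      then show ?thesis using Aut[of X] Aut[of Y] by (simp add: field_simps)
    qed
    then show ?thesis by (simp add: c_def c'_def mult.assoc)
  qed
qed

end
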